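(* Let $r > 0$, $L > 0$ and let $T$ be a positive integer. For every deterministic first-order algorithm $\mathcal{A}$, there exists an $L$-smooth g-convex function $f \in \mathcal{F}_{r, \infty, 0, L}$ such that $\mathcal{A}$ requires at least $T$ queries to find a point $x$ with $f(x) - f^* \leq \frac{1}{2} L r^2 \cdot \frac{1}{8 \zeta_r^2 T^2}$, where $\zeta_r = \frac{r}{\tanh(r)}$; that is, $T_\delta(\mathcal{A}, f)\ge T$ with $\delta = \frac{1}{2}Lr^2\cdot\frac{1}{8\zeta_r^2T^2}$.
   Context: $\mathbb{H}^d$ ($d\ge 2$) is $d$-dimensional hyperbolic space of constant sectional curvature $-1$, with a fixed reference point $x_{\mathrm{ref}} = x_{\mathrm{ref}}^d\in \mathbb{H}^d$; $\mathrm{dist}$ is Riemannian distance, $B(x,r) = \{y : \mathrm{dist}(x,y)\le r\}$, and $P_{x\to y}$ is parallel transport along the geodesic from $x$ to $y$. Below, $\mathcal{M}=\mathbb{H}^d$. A function $f:\mathbb{H}^d\to\mathbb{R}$ is g-convex if $f(\gamma(t)) \le (1-t)f(x)+tf(y)$ for every geodesic $\gamma:[0,1]\to\mathbb{H}^d$ from $x$ to $y$ and $t\in[0,1]$. A differentiable $f$ is $L$-smooth if $\|\nabla f(x)-P_{y\to x}\nabla f(y)\|\le L\,\mathrm{dist}(x,y)$ for all $x,y$. $f^*=\min f$. $\mathcal{F}^d_{r,\infty,0,L}$ is the class of functions $f:\mathbb{H}^d\to\mathbb{R}$ that are globally g-convex, globally $L$-smooth, and have a global minimizer in $B(x_{\mathrm{ref}},r)$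 (no Lipschitz requirement on $f$); $\mathcal{F}_{r,\infty,0,L}=\bigcup_{d\ge 2}\mathcal{F}^d_{r,\infty,0,L}$. A deterministic first-order algorithm on $\mathcal{M}$ is a sequence of functions $\mathcal{A}_k:(\mathbb{R}\times \mathrm{T}\mathcal{M})^k\to\mathcal{M}$, $k\ge 0$ ($\mathcal{A}_0$ is just an initial point $x_0$); for a class that is a union over dimensions, an algorithm consists of one such sequence for each $\mathbb{H}^d$. Running $\mathcal{A}$ on a differentiable g-convex $f$ produces $x_k=\mathcal{A}_k\big((f(x_\ell),(x_\ell,\nabla f(x_\ell)))_{\ell=0}^{k-1}\big)$. $T_\delta(\mathcal{A},f)$ is the first index $k$ (starting from $0$) with $f(x_k)-f^*\le\delta$. *)

theory Defs
  imports "HOL-Analysis.Analysis" "HOL-Library.Extended_Nat"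
begin

text \<open>
  Hyperbolic space is realised by the hyperboloid model, with carrier \<open>hyp d\<close>.
  The dimension \<open>d\<close> has to be quantified inside the main statement, so it is a natural number and
  not a type.  Vectors of the ambient Minkowski space \<open>\<real>\<^bsup>d,1\<^esup>\<close> are functions \<open>nat \<Rightarrow> real\<close> vanishing
  above \<open>d\<close>; coordinate \<open>0\<close> is the time-like one.
\<close>

type_synonym vec = "nat \<Rightarrow> real"

definition minkowski_space :: "nat \<Rightarrow> vec set" where
  "minkowski_space d = {x. \<forall>i>d. x i = 0}"

definition mink :: "nat \<Rightarrow> vec \<Rightarrow> vec \<Rightarrow> real" where
  "mink d x y = (\<Sum>i=1..d. x i * y i) - x 0 * y 0"

definition hyp :: "nat \<Rightarrow> vec set" where
  "hyp d = {x \<in> minkowski_space d. mink d x x = -1 \<and> x 0 > 0}"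

definition tangent :: "nat \<Rightarrow> vec \<Rightarrow> vec set" where
  "tangent d x = {v \<in> minkowski_space d. mink d x v = 0}"

definition tangent_bundle :: "nat \<Rightarrow> (vec \<times> vec) set" where
  "tangent_bundle d = Sigma (hyp d) (tangent d)"

text \<open>The Riemannian metric of \<open>hyp d\<close> is the restriction of \<open>mink d\<close> to the tangent spaces.\<close>

definition tnorm :: "nat \<Rightarrow> vec \<Rightarrow> real" where
  "tnorm d v = sqrt (mink d v v)"

definition hdist :: "nat \<Rightarrow> vec \<Rightarrow> vec \<Rightarrow> real" where
  "hdist d x y = arcosh (- mink d x y)"

definition hball :: "nat \<Rightarrow> vec \<Rightarrow> real \<Rightarrow> vec set" where
  "hball d x r = {y \<in> hyp d. hdist d x y \<le> r}"

definition has_velocity :: "(real \<Rightarrow> vec) \<Rightarrow> vec \<Rightarrow> real \<Rightarrow> bool" where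
  "has_velocity c v t \<longleftrightarrow> (\<forall>i. ((\<lambda>s. c s i) has_real_derivative v i) (at t within {0..1}))"

text \<open>
  The Levi-Civita covariant derivative on \<open>hyp d\<close> is the tangential part of the ambient derivative.
  Hence a tangent field along a curve is parallel iff its ambient derivative is orthogonal to the
  tangent spaces, and a geodesic is a curve whose velocity is parallel.
\<close>

definition parallel_along :: "nat \<Rightarrow> (real \<Rightarrow> vec) \<Rightarrow> (real \<Rightarrow> vec) \<Rightarrow> bool" where
  "parallel_along d c V \<longleftrightarrow>
     (\<forall>t\<in>{0..1}. V t \<in> tangent d (c t) \<and>
        (\<exists>W. has_velocity V W t \<and> (\<forall>u\<in>tangent d (c t). mink d W u = 0)))"

definition geodesic :: "nat \<Rightarrow> (real \<Rightarrow> vec) \<Rightarrow> (real \<Rightarrow> vec) \<Rightarrow> bool" where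
  "geodesic d c c' \<longleftrightarrow>
     (\<forall>t\<in>{0..1}. c t \<in> hyp d \<and> has_velocity c (c' t) t) \<and> parallel_along d c c'"

definition transport :: "nat \<Rightarrow> vec \<Rightarrow> vec \<Rightarrow> vec \<Rightarrow> vec" where
  "transport d x y v =
     (THE w. \<exists>c c' V. geodesic d c c' \<and> c 0 = x \<and> c 1 = y \<and>
                      parallel_along d c V \<and> V 0 = v \<and> V 1 = w)"

lemma mink_commute: "mink d x y = mink d y x"
  by (simp add: mink_def mult.commute)

lemma mink_add_right: "mink d x (\<lambda>i. y i + z i) = mink d x y + mink d x z"
  by (simp add: mink_def algebra_simps sum.distrib)

lemma mink_diff_right: "mink d x (\<lambda>i. y i - z i) = mink d x y - mink d x z"
  by (simp add: mink_def algebra_simps sum_subtractf)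

lemma mink_scale_right: "mink d x (\<lambda>i. a * y i) = a * mink d x y"
  by (simp add: mink_def algebra_simps sum_distrib_left)

lemma mink_add_left: "mink d (\<lambda>i. y i + z i) x = mink d y x + mink d z x"
  by (simp add: mink_def algebra_simps sum.distrib)

lemma mink_diff_left: "mink d (\<lambda>i. y i - z i) x = mink d y x - mink d z x"
  by (simp add: mink_def algebra_simps sum_subtractf)

lemma mink_scale_left: "mink d (\<lambda>i. a * y i) x = a * mink d y x"
  by (simp add: mink_def algebra_simps sum_distrib_left)

lemma mink_combination_right:
  "mink d y (\<lambda>i. a * x i + b * z i) = a * mink d y x + b * mink d y z"
  by (simp only: mink_add_right mink_scale_right)

lemma mink_combination_left:
  "mink d (\<lambda>i. a * x i + b * z i) y = a * mink d x y + b * mink d z y"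
  by (simp only: mink_add_left mink_scale_left)

lemmas mink_combination = mink_combination_right mink_combination_left

lemmas mink_linear = mink_add_right mink_diff_right mink_scale_right
  mink_add_left mink_diff_left mink_scale_left

lemma hypD: "x \<in> hyp d \<Longrightarrow> mink d x x = -1" "x \<in> hyp d \<Longrightarrow> x 0 > 0"
  "x \<in> hyp d \<Longrightarrow> x \<in> minkowski_space d"
  by (auto simp: hyp_def)

lemma tangentD: "v \<in> tangent d x \<Longrightarrow> mink d x v = 0" "v \<in> tangent d x \<Longrightarrow> mink d v x = 0"
  "v \<in> tangent d x \<Longrightarrow> v \<in> minkowski_space d"
  by (auto simp: tangent_def mink_commute)

lemma cauchy_schwarz_sum:
  fixes x y :: vec
  shows "(\<Sum>i=1..d. x i * y i)\<^sup>2 \<le> (\<Sum>i=1..d. (x i)\<^sup>2) * (\<Sum>i=1..d. (y i)\<^sup>2)"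
  by (rule Cauchy_Schwarz_ineq_sum)

lemma tangent_norm_bound:
  assumes x: "x \<in> hyp d" and v: "v \<in> tangent d x"
  shows "(\<Sum>i=1..d. (v i)\<^sup>2) \<le> (1 + (\<Sum>i=1..d. (x i)\<^sup>2)) * mink d v v"
proof -
  let ?S = "\<Sum>i=1..d. (x i)\<^sup>2" and ?V = "\<Sum>i=1..d. (v i)\<^sup>2"
  have 1: "(x 0)\<^sup>2 = 1 + ?S"
    using hypD(1)[OF x] by (simp add: mink_def power2_eq_square)
  have "(\<Sum>i=1..d. x i * v i) = x 0 * v 0"
    using tangentD(1)[OF v] by (simp add: mink_def)
  with cauchy_schwarz_sum[of x v d] have "(x 0)\<^sup>2 * (v 0)\<^sup>2 \<le> ?S * ?V"
    by (simp add: power_mult_distrib)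
  hence 2: "(1 + ?S) * (v 0)\<^sup>2 \<le> ?S * ?V" by (simp only: 1)
  have 3: "mink d v v = ?V - (v 0)\<^sup>2"
    by (simp add: mink_def power2_eq_square)
  from 2 show ?thesis
    unfolding 3 right_diff_distrib distrib_right by simp
qed

lemma one_plus_sum_squares_pos: "0 < 1 + (\<Sum>i=1..d. (x i :: real)\<^sup>2)"
  by (smt (verit) sum_nonneg zero_le_power2)

lemma mink_tangent_nonneg:
  assumes x: "x \<in> hyp d" and v: "v \<in> tangent d x"
  shows "mink d v v \<ge> 0"
proof -
  have "0 \<le> (\<Sum>i=1..d. (v i)\<^sup>2)" by (simp add: sum_nonneg)
  with tangent_norm_bound[OF assms] have "0 \<le> (1 + (\<Sum>i=1..d. (x i)\<^sup>2)) * mink d v v"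
    by linarith
  with one_plus_sum_squares_pos[of x d] show ?thesis
    by (simp add: zero_le_mult_iff)
qed

lemma mink_tangent_eq_0:
  assumes x: "x \<in> hyp d" and v: "v \<in> tangent d x" and 0: "mink d v v = 0"
  shows "v = (\<lambda>_. 0)"
proof
  fix i
  have s: "(\<Sum>i=1..d. (v i)\<^sup>2) = 0"
    using tangent_norm_bound[OF x v] by (simp add: 0 order_antisym sum_nonneg)
  hence z: "\<forall>i\<in>{1..d}. v i = 0" by (simp add: sum_nonneg_eq_0_iff)
  hence "v 0 = 0" using 0 s by (simp add: mink_def)
  with z show "v i = 0"
    using tangentD(3)[OF v] by (cases "i = 0 \<or> i > d") (auto simp: minkowski_space_def)
qed

lemma tnorm_sq: "x \<in> hyp d \<Longrightarrow> v \<in> tangent d x \<Longrightarrow> (tnorm d v)\<^sup>2 = mink d v v"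
  by (simp add: tnorm_def mink_tangent_nonneg)

lemma tnorm_eq_0: "x \<in> hyp d \<Longrightarrow> v \<in> tangent d x \<Longrightarrow> tnorm d v = 0 \<Longrightarrow> v = (\<lambda>_. 0)"
  by (metis mink_tangent_eq_0 tnorm_sq zero_power2)

lemma tnorm_nonneg: "x \<in> hyp d \<Longrightarrow> v \<in> tangent d x \<Longrightarrow> tnorm d v \<ge> 0"
  by (simp add: tnorm_def mink_tangent_nonneg)

lemma tnorm_scale: "tnorm d (\<lambda>i. a * v i) = \<bar>a\<bar> * tnorm d v"
  unfolding tnorm_def mink_scale_left mink_scale_right
  by (simp add: real_sqrt_mult flip: mult.assoc)

lemma mink_hyp_le:
  assumes x: "x \<in> hyp d" and y: "y \<in> hyp d"
  shows "mink d x y \<le> -1"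
proof -
  let ?w = "\<lambda>i. y i + mink d x y * x i"
  have w: "?w \<in> tangent d x"
    using hypD[OF x] hypD[OF y] by (simp add: tangent_def minkowski_space_def mink_linear)
  have "mink d ?w ?w = (mink d x y)\<^sup>2 - 1"
    using hypD(1)[OF x] hypD(1)[OF y] mink_commute[of d y x]
    by (simp add: mink_linear power2_eq_square)
  with mink_tangent_nonneg[OF x w] have "1\<^sup>2 \<le> \<bar>mink d x y\<bar>\<^sup>2" by simp
  hence a: "1 \<le> \<bar>mink d x y\<bar>" by (rule power2_le_imp_le) simp
  let ?S = "\<Sum>i=1..d. (x i)\<^sup>2" and ?U = "\<Sum>i=1..d. (y i)\<^sup>2"
  have 1: "(x 0)\<^sup>2 = 1 + ?S" "(y 0)\<^sup>2 = 1 + ?U"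
    using hypD(1)[OF x] hypD(1)[OF y] by (simp_all add: mink_def power2_eq_square)
  have "?S * ?U \<le> (x 0)\<^sup>2 * (y 0)\<^sup>2"
    unfolding 1 by (intro mult_mono) (auto simp: sum_nonneg intro: add_nonneg_nonneg)
  with cauchy_schwarz_sum[of x y d] have "(\<Sum>i=1..d. x i * y i)\<^sup>2 \<le> (x 0 * y 0)\<^sup>2"
    by (simp add: power_mult_distrib)
  hence "(\<Sum>i=1..d. x i * y i) \<le> x 0 * y 0"
    by (rule power2_le_imp_le) (use hypD(2)[OF x] hypD(2)[OF y] in simp)
  with a show ?thesis by (simp add: mink_def)
qed

lemma has_velocityD:
  "has_velocity c v t \<Longrightarrow> ((\<lambda>s. c s i) has_real_derivative v i) (at t within {0..1})"
  by (simp add: has_velocity_def)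

lemma mink_has_derivative:
  assumes "has_velocity a a' t" "has_velocity b b' t"
  shows "((\<lambda>s. mink d (a s) (b s)) has_real_derivative (mink d a' (b t) + mink d (a t) b'))
           (at t within {0..1})"
  unfolding mink_def
  by (rule derivative_eq_intros has_velocityD[OF assms(1)] has_velocityD[OF assms(2)] refl)+
    (simp add: sum.distrib algebra_simps)

lemma constant_on_unit_interval:
  fixes g :: "real \<Rightarrow> real"
  assumes "\<And>t. t \<in> {0..1} \<Longrightarrow> (g has_real_derivative 0) (at t within {0..1})" "t \<in> {0..1}"
  shows "g t = g 0"
  using has_field_derivative_zero_constant[of "{0..1}" g] assms by fastforce

lemma parallel_unique:
  assumes c: "\<And>t. t \<in> {0..1} \<Longrightarrow> c t \<in> hyp d"
    and V: "parallel_along d c V" and W: "parallel_along d c W" and 0: "V 0 = W 0"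
    and t: "t \<in> {0..1}"
  shows "V t = W t"
proof -
  define D where "D = (\<lambda>t i. V t i - W t i)"
  have tan: "D t \<in> tangent d (c t)" if "t \<in> {0..1}" for t
    using V W that
    by (auto simp: D_def parallel_along_def tangent_def minkowski_space_def mink_linear)
  have "((\<lambda>s. mink d (D s) (D s)) has_real_derivative 0) (at t within {0..1})"
    if t: "t \<in> {0..1}" for t
  proof -
    obtain A where A: "has_velocity V A t" "\<forall>u\<in>tangent d (c t). mink d A u = 0"
      using V t unfolding parallel_along_def by blast
    obtain B where B: "has_velocity W B t" "\<forall>u\<in>tangent d (c t). mink d B u = 0"
      using W t unfolding parallel_along_def by blast
    have "has_velocity D (\<lambda>i. A i - B i) t"
      unfolding D_def has_velocity_def
      by (intro allI derivative_intros has_velocityD[OF A(1)] has_velocityD[OF B(1)])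
    from mink_has_derivative[OF this this, of d] show ?thesis
      using A(2) B(2) tan[OF t] by (simp add: mink_linear mink_commute[of d "D t"])
  qed
  from constant_on_unit_interval[of "\<lambda>s. mink d (D s) (D s)", OF this t]
  have "mink d (D t) (D t) = 0" by (simp add: D_def 0 mink_def)
  from mink_tangent_eq_0[OF c[OF t] tan[OF t] this] show ?thesis
    by (auto simp: D_def fun_eq_iff)
qed

text \<open>At \<open>v = 0\<close> the quotient below is \<open>0 / 0 = 0\<close>, and the formula gives \<open>x\<close>, as it should.\<close>

definition hexp :: "nat \<Rightarrow> vec \<Rightarrow> vec \<Rightarrow> real \<Rightarrow> vec" where
  "hexp d x v t = (\<lambda>i. cosh (t * tnorm d v) * x i + sinh (t * tnorm d v) / tnorm d v * v i)"

definition hexp' :: "nat \<Rightarrow> vec \<Rightarrow> vec \<Rightarrow> real \<Rightarrow> vec" where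
  "hexp' d x v t = (\<lambda>i. tnorm d v * sinh (t * tnorm d v) * x i + cosh (t * tnorm d v) * v i)"

lemma cosh_sq_real: "(cosh t)\<^sup>2 = 1 + (sinh t)\<^sup>2" for t :: real
  using hyperbolic_pythagoras[of t] by linarith

lemma hexp_has_velocity:
  assumes "x \<in> hyp d" "v \<in> tangent d x"
  shows "has_velocity (hexp d x v) (hexp' d x v t) t"
    and "has_velocity (hexp' d x v) (\<lambda>i. mink d v v * hexp d x v t i) t"
proof -
  have z: "v i = 0" if "tnorm d v = 0" for i
    using tnorm_eq_0[OF assms that] by simp
  show "has_velocity (hexp d x v) (hexp' d x v t) t"
    unfolding has_velocity_def hexp_def hexp'_def
    by (cases "tnorm d v = 0") (auto intro!: derivative_eq_intros simp: z)
  show "has_velocity (hexp' d x v) (\<lambda>i. mink d v v * hexp d x v t i) t"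
    unfolding has_velocity_def hexp_def hexp'_def tnorm_sq[OF assms, symmetric]
    by (cases "tnorm d v = 0")
      (auto intro!: derivative_eq_intros simp: z algebra_simps power2_eq_square)
qed

lemma hexp_in_hyp:
  assumes x: "x \<in> hyp d" and v: "v \<in> tangent d x"
  shows "hexp d x v t \<in> hyp d"
proof -
  let ?n = "tnorm d v" and ?y = "hexp d x v t"
  have amb: "?y \<in> minkowski_space d"
    using hypD(3)[OF x] tangentD(3)[OF v] by (simp add: hexp_def minkowski_space_def)
  have "mink d ?y ?y = - (cosh (t * ?n))\<^sup>2 + (sinh (t * ?n) / ?n)\<^sup>2 * ?n\<^sup>2"
    unfolding tnorm_sq[OF x v] hexp_def mink_combination
    using hypD(1)[OF x] tangentD(1,2)[OF v] by (simp add: power2_eq_square)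
  also have "(sinh (t * ?n) / ?n)\<^sup>2 * ?n\<^sup>2 = (sinh (t * ?n))\<^sup>2"
    by (cases "?n = 0") (auto simp: power_divide)
  finally have q: "mink d ?y ?y = -1" by (simp add: cosh_sq_real)
  have xy: "mink d x ?y = - cosh (t * ?n)"
    unfolding hexp_def mink_combination using hypD(1)[OF x] tangentD(1)[OF v] by simp
  have "?y 0 > 0"
  proof (rule ccontr)
    assume "\<not> ?y 0 > 0"
    moreover have "(?y 0)\<^sup>2 > 0"
      using q one_plus_sum_squares_pos[of ?y d] by (simp add: mink_def power2_eq_square)
    ultimately have "- ?y 0 > 0" by auto
    have "(\<lambda>i. - ?y i) \<in> hyp d"
      using amb q \<open>- ?y 0 > 0\<close> by (simp add: hyp_def minkowski_space_def mink_def)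
    from mink_hyp_le[OF x this] have "mink d x ?y \<ge> 1"
      using mink_scale_right[of d x "-1" ?y] by simp
    with xy cosh_real_pos[of "t * ?n"] show False by linarith
  qed
  with amb q show ?thesis by (simp add: hyp_def)
qed

lemma hexp'_tangent:
  assumes x: "x \<in> hyp d" and v: "v \<in> tangent d x"
  shows "hexp' d x v t \<in> tangent d (hexp d x v t)"
proof -
  let ?n = "tnorm d v"
  have "mink d (hexp d x v t) (hexp' d x v t) =
      cosh (t * ?n) * (sinh (t * ?n) / ?n * ?n\<^sup>2 - ?n * sinh (t * ?n))"
    unfolding tnorm_sq[OF x v] hexp_def hexp'_def mink_combination
    using hypD(1)[OF x] tangentD(1,2)[OF v] by (simp add: algebra_simps)
  also have "\<dots> = 0" by (simp add: power2_eq_square)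
  finally show ?thesis
    using hypD(3)[OF x] tangentD(3)[OF v]
    by (simp add: tangent_def hexp'_def minkowski_space_def)
qed

lemma hexp_geodesic:
  assumes x: "x \<in> hyp d" and v: "v \<in> tangent d x"
  shows "geodesic d (hexp d x v) (hexp' d x v)" "hexp d x v 0 = x" "hexp' d x v 0 = v"
proof -
  show "geodesic d (hexp d x v) (hexp' d x v)"
    unfolding geodesic_def parallel_along_def
  proof (intro conjI ballI)
    fix t :: real
    show "\<exists>W. has_velocity (hexp' d x v) W t \<and> (\<forall>u\<in>tangent d (hexp d x v t). mink d W u = 0)"
      by (rule exI, rule conjI, rule hexp_has_velocity(2)[OF x v])
        (simp add: mink_linear tangentD)
  qed (simp_all add: hexp_in_hyp hexp'_tangent hexp_has_velocity x v)
qed (simp_all add: hexp_def hexp'_def)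

lemma normal_eq_scaled:
  assumes y: "y \<in> hyp d" and W: "W \<in> minkowski_space d"
    and normal: "\<forall>u\<in>tangent d y. mink d W u = 0"
  shows "W = (\<lambda>i. - mink d W y * y i)"
proof -
  let ?w = "\<lambda>i. W i + mink d W y * y i"
  have t: "?w \<in> tangent d y"
    using W hypD[OF y] mink_commute[of d y W]
    by (simp add: tangent_def minkowski_space_def mink_linear)
  have "mink d ?w ?w = mink d W ?w + mink d W y * mink d y ?w"
    by (simp only: mink_add_left mink_scale_left)
  also have "\<dots> = 0" using normal t by (simp add: tangentD(1))
  finally have "mink d ?w ?w = 0" .
  from mink_tangent_eq_0[OF y t this] show ?thesis
    by (simp add: fun_eq_iff add_eq_0_iff2)
qed

lemma velocity_in_minkowski_space:
  assumes t: "t \<in> {0..1}" and V: "\<And>s. s \<in> {0..1} \<Longrightarrow> V s \<in> minkowski_space d"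
    and W: "has_velocity V W t"
  shows "W \<in> minkowski_space d"
  unfolding minkowski_space_def
proof safe
  fix i assume i: "i > d"
  have "((\<lambda>s. 0) has_real_derivative W i) (at t within {0..1})"
    by (rule has_field_derivative_transform_within[OF has_velocityD[OF W, of i] zero_less_one t])
      (use V i in \<open>auto simp: minkowski_space_def\<close>)
  moreover have "((\<lambda>s. 0::real) has_real_derivative 0) (at t within {0..1})" by simp
  moreover have "at t within {0..1} \<noteq> (bot :: real filter)"
    using t by (simp add: trivial_limit_within islimpt_Icc)
  ultimately show "W i = 0"
    by (rule has_field_derivative_unique)
qed

lemma ode_unique:
  fixes y y' :: "real \<Rightarrow> real"
  assumes y: "\<And>t. t \<in> {0..1} \<Longrightarrow> (y has_real_derivative y' t) (at t within {0..1})"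
    and y': "\<And>t. t \<in> {0..1} \<Longrightarrow> (y' has_real_derivative n\<^sup>2 * y t) (at t within {0..1})"
    and 0: "y 0 = 0" "y' 0 = 0" and t: "t \<in> {0..1}"
  shows "y t = 0 \<and> y' t = 0"
proof -
  have *: "(y' t - m * y t) * exp (m * t) = 0" if "m\<^sup>2 = n\<^sup>2" "t \<in> {0..1}" for m t
  proof -
    have mn: "n\<^sup>2 = m * m" using that(1) by (simp add: power2_eq_square)
    have "(y' t - m * y t) * exp (m * t) = (y' 0 - m * y 0) * exp (m * 0)"
      by (rule constant_on_unit_interval[of "\<lambda>t. (y' t - m * y t) * exp (m * t)"])
        (use that in \<open>auto intro!: derivative_eq_intros y y'
           simp: algebra_simps mn\<close>)
    thus ?thesis by (simp add: 0)
  qed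
  show ?thesis
  proof (cases "n = 0")
    case False
    with *[of n t] *[of "-n" t] t show ?thesis by auto
  next
    case True
    have y'0: "y' t = 0" if "t \<in> {0..1}" for t using *[of 0 t] that True by simp
    have "y t = y 0"
      by (rule constant_on_unit_interval[OF _ t]) (use y y'0 in force)
    with 0 y'0[OF t] show ?thesis by simp
  qed
qed

lemma geodesic_eq_hexp:
  assumes g: "geodesic d c c'" and t: "t \<in> {0..1}"
  shows "c t = hexp d (c 0) (c' 0) t \<and> c' t = hexp' d (c 0) (c' 0) t"
proof -
  have c: "c s \<in> hyp d" "has_velocity c (c' s) s" "c' s \<in> tangent d (c s)"
    if "s \<in> {0..1}" for s
    using g that by (auto simp: geodesic_def parallel_along_def)
  let ?m = "mink d (c' 0) (c' 0)"
  have m: "?m = (tnorm d (c' 0))\<^sup>2" using c[of 0] by (simp add: tnorm_sq)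
  have acc: "\<exists>W. has_velocity c' W s \<and> (\<forall>u\<in>tangent d (c s). mink d W u = 0)"
    if "s \<in> {0..1}" for s
    using g that by (auto simp: geodesic_def parallel_along_def)
  have const: "mink d (c' s) (c' s) = ?m" if "s \<in> {0..1}" for s
  proof (rule constant_on_unit_interval[OF _ that])
    fix s :: real assume s: "s \<in> {0..1}"
    from acc[OF s] obtain W
      where W: "has_velocity c' W s" "\<forall>u\<in>tangent d (c s). mink d W u = 0" by blast
    from mink_has_derivative[OF W(1) W(1), of d]
    show "((\<lambda>s. mink d (c' s) (c' s)) has_real_derivative 0) (at s within {0..1})"
      using W(2) c(3)[OF s] by (simp add: mink_commute[of d "c' s"])
  qed
  have acc': "has_velocity c' (\<lambda>i. ?m * c s i) s" if s: "s \<in> {0..1}" for s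
  proof -
    from acc[OF s] obtain W
      where W: "has_velocity c' W s" "\<forall>u\<in>tangent d (c s). mink d W u = 0" by blast
    have "W \<in> minkowski_space d"
      by (rule velocity_in_minkowski_space[OF s _ W(1)]) (use c(3) tangentD(3) in blast)
    from normal_eq_scaled[OF c(1)[OF s] this W(2)] have "W = (\<lambda>i. - mink d W (c s) * c s i)" .
    moreover have "mink d W (c s) = - ?m"
    proof -
      have "((\<lambda>s. mink d (c' s) (c s)) has_real_derivative
              mink d W (c s) + mink d (c' s) (c' s)) (at s within {0..1})"
        by (rule mink_has_derivative[OF W(1) c(2)[OF s]])
      moreover have "((\<lambda>s. mink d (c' s) (c s)) has_real_derivative 0) (at s within {0..1})"
        by (rule has_field_derivative_transform_within[of "\<lambda>_. 0", OF _ zero_less_one s])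
          (use c(3) tangentD(2) in auto)
      moreover have "at s within {0..1} \<noteq> (bot :: real filter)"
        using s by (simp add: trivial_limit_within islimpt_Icc)
      ultimately have "mink d W (c s) + mink d (c' s) (c' s) = 0"
        by (rule has_field_derivative_unique)
      with const[OF s] show ?thesis by simp
    qed
    ultimately show ?thesis using W(1) by simp
  qed
  let ?e = "hexp d (c 0) (c' 0)" and ?e' = "hexp' d (c 0) (c' 0)"
  have e: "has_velocity ?e (?e' s) s" "has_velocity ?e' (\<lambda>i. ?m * ?e s i) s" for s
    using hexp_has_velocity c[of 0] by auto
  have e0: "?e 0 = c 0" "?e' 0 = c' 0" using hexp_geodesic c[of 0] by auto
  have "c t i - ?e t i = 0 \<and> c' t i - ?e' t i = 0" for i
  proof (rule ode_unique[OF _ _ _ _ t, of _ _ "tnorm d (c' 0)"])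
    fix s :: real assume s: "s \<in> {0..1}"
    show "((\<lambda>t. c t i - ?e t i) has_real_derivative c' s i - ?e' s i) (at s within {0..1})"
      by (intro derivative_intros has_velocityD c(2) e s)
    have "((\<lambda>t. c' t i - ?e' t i) has_real_derivative ?m * c s i - ?m * ?e s i)
            (at s within {0..1})"
      by (intro derivative_intros has_velocityD[OF acc'[OF s]] has_velocityD[OF e(2)])
    thus "((\<lambda>t. c' t i - ?e' t i) has_real_derivative
            (tnorm d (c' 0))\<^sup>2 * (c s i - ?e s i)) (at s within {0..1})"
      unfolding m[symmetric] by (simp add: algebra_simps)
  qed (simp_all add: e0)
  thus ?thesis by (simp add: fun_eq_iff)
qed

lemma hdist_hexp:
  assumes x: "x \<in> hyp d" and v: "v \<in> tangent d x"
  shows "hdist d (hexp d x v s) (hexp d x v t) = \<bar>s - t\<bar> * tnorm d v"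
proof -
  let ?n = "tnorm d v"
  have "mink d (hexp d x v s) (hexp d x v t) =
      - cosh (s * ?n) * cosh (t * ?n) + (sinh (s * ?n) / ?n) * (sinh (t * ?n) / ?n) * ?n\<^sup>2"
    unfolding tnorm_sq[OF x v] hexp_def mink_combination
    using hypD(1)[OF x] tangentD(1,2)[OF v] by simp
  also have "(sinh (s * ?n) / ?n) * (sinh (t * ?n) / ?n) * ?n\<^sup>2 = sinh (s * ?n) * sinh (t * ?n)"
    by (cases "?n = 0") (auto simp: power2_eq_square)
  finally have "- mink d (hexp d x v s) (hexp d x v t) = cosh (s * ?n - t * ?n)"
    by (simp add: cosh_diff)
  also have "\<dots> = cosh (\<bar>s * ?n - t * ?n\<bar>)" by simp
  also have "\<bar>s * ?n - t * ?n\<bar> = \<bar>s - t\<bar> * ?n"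
    using tnorm_nonneg[OF x v] by (simp add: abs_mult flip: left_diff_distrib)
  finally show ?thesis
    using tnorm_nonneg[OF x v] by (simp add: hdist_def arcosh_cosh_real)
qed

lemma geodesic_hdist:
  assumes g: "geodesic d c c'" and "s \<in> {0..1}" "t \<in> {0..1}"
  shows "hdist d (c s) (c t) = \<bar>s - t\<bar> * tnorm d (c' 0)"
proof -
  have "c 0 \<in> hyp d" "c' 0 \<in> tangent d (c 0)"
    using g by (auto simp: geodesic_def parallel_along_def)
  from hdist_hexp[OF this] geodesic_eq_hexp[OF g assms(2)] geodesic_eq_hexp[OF g assms(3)]
  show ?thesis by simp
qed

lemma geodesic_exists:
  assumes x: "x \<in> hyp d" and y: "y \<in> hyp d"
  obtains v where "v \<in> tangent d x" "hexp d x v 1 = y"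
proof -
  define k where "k = - mink d x y"
  define w where "w = (\<lambda>i. y i - k * x i)"
  define v where "v = (\<lambda>i. arcosh k / tnorm d w * w i)"
  have k: "k \<ge> 1" using mink_hyp_le[OF x y] by (simp add: k_def)
  have w: "w \<in> tangent d x"
    using hypD[OF x] hypD[OF y]
    by (simp add: tangent_def minkowski_space_def mink_linear w_def k_def)
  have "mink d x v = 0"
    unfolding v_def mink_scale_right using tangentD(1)[OF w] by simp
  hence v: "v \<in> tangent d x"
    using tangentD(3)[OF w] by (simp add: tangent_def minkowski_space_def v_def)
  have ww: "mink d w w = k\<^sup>2 - 1"
    using hypD(1)[OF x] hypD(1)[OF y] mink_commute[of d y x]
    by (simp add: w_def mink_linear power2_eq_square k_def)
  have nv: "tnorm d v = \<bar>arcosh k / tnorm d w\<bar> * tnorm d w"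
    unfolding v_def by (rule tnorm_scale)
  have "hexp d x v 1 i = y i" for i
  proof (cases "k = 1")
    case True
    hence "mink d w w = 0" using ww by simp
    from mink_tangent_eq_0[OF x w this] have "y i = x i" "v i = 0"
      using True by (auto simp: w_def v_def fun_eq_iff)
    moreover have "tnorm d v = 0" using True nv by simp
    ultimately show ?thesis by (simp add: hexp_def)
  next
    case False
    with k have k1: "k > 1" by simp
    hence nw: "tnorm d w > 0" by (simp add: tnorm_def ww)
    have ac: "arcosh k > 0" using k1 by simp
    hence n: "tnorm d v = arcosh k" using nv nw by simp
    have sh: "sinh (arcosh k) = tnorm d w"
      using k by (simp add: sinh_arcosh_real tnorm_def ww)
    have vi: "v i = arcosh k / tnorm d w * w i" by (simp add: v_def)
    have "hexp d x v 1 i = k * x i + w i"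
      unfolding hexp_def n vi using nw ac k sh by simp
    thus ?thesis by (simp add: w_def)
  qed
  with v that show ?thesis by blast
qed

lemma hexp_inj:
  assumes x: "x \<in> hyp d" and v: "v \<in> tangent d x" and w: "w \<in> tangent d x"
    and eq: "hexp d x v 1 = hexp d x w 1"
  shows "v = w"
proof -
  have 1: "hexp d x u 0 = x" for u by (simp add: hexp_def)
  have n: "tnorm d v = tnorm d w"
    using hdist_hexp[OF x v, of 0 1] hdist_hexp[OF x w, of 0 1] by (simp add: 1 eq)
  show ?thesis
  proof (cases "tnorm d v = 0")
    case True
    with n tnorm_eq_0[OF x v] tnorm_eq_0[OF x w] show ?thesis by simp
  next
    case False
    with eq show ?thesis by (simp add: hexp_def n fun_eq_iff)
  qed
qed

lemma hexp_parallel: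
  assumes x: "x \<in> hyp d" and v: "v \<in> tangent d x" and u: "u \<in> tangent d x"
  shows "parallel_along d (hexp d x v)
           (\<lambda>t i. u i + mink d u v / mink d v v * (hexp' d x v t i - v i))"
    (is "parallel_along d _ ?V")
  unfolding parallel_along_def
proof (intro ballI conjI)
  fix t :: real
  let ?n = "tnorm d v" and ?a = "mink d u v / mink d v v"
  have z: "v = (\<lambda>_. 0)" if "mink d v v = 0" using mink_tangent_eq_0[OF x v that] .
  have amb: "?V t \<in> minkowski_space d"
    using hypD(3)[OF x] tangentD(3)[OF v] tangentD(3)[OF u]
    by (simp add: minkowski_space_def hexp'_def)
  have 1: "mink d (hexp d x v t) u = sinh (t * ?n) / ?n * mink d u v"
    "mink d (hexp d x v t) v = sinh (t * ?n) / ?n * mink d v v"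
    unfolding hexp_def mink_combination using tangentD[OF v] tangentD[OF u] mink_commute[of d v u]
    by simp_all
  have "mink d (hexp d x v t) (?V t) =
      sinh (t * ?n) / ?n * mink d u v - ?a * (sinh (t * ?n) / ?n * mink d v v)"
    unfolding mink_add_right mink_scale_right mink_diff_right 1
      tangentD(1)[OF hexp'_tangent[OF x v, of t]] by simp
  also have "\<dots> = 0"
  proof (cases "mink d v v = 0")
    case True
    then show ?thesis using z by (simp add: mink_def tnorm_def)
  qed simp
  finally show "?V t \<in> tangent d (hexp d x v t)" using amb by (simp add: tangent_def)
  show "\<exists>W. has_velocity ?V W t \<and> (\<forall>u\<in>tangent d (hexp d x v t). mink d W u = 0)"
  proof (rule exI, rule conjI)
    show "has_velocity ?V (\<lambda>i. ?a * (mink d v v * hexp d x v t i)) t"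
      using hexp_has_velocity(2)[OF x v, of t] unfolding has_velocity_def
      by (auto intro!: derivative_eq_intros)
  qed (auto simp only: mink_scale_left tangentD(1) mult_zero_right)
qed

lemma transport_hexp:
  assumes x: "x \<in> hyp d" and v: "v \<in> tangent d x" and u: "u \<in> tangent d x"
  shows "transport d x (hexp d x v 1) u =
           (\<lambda>i. u i + mink d u v / mink d v v * (hexp' d x v 1 i - v i))"
  unfolding transport_def
proof (rule the_equality, goal_cases)
  case 1
  show ?case
    by (rule exI[of _ "hexp d x v"], rule exI[of _ "hexp' d x v"],
        rule exI[of _ "\<lambda>t i. u i + mink d u v / mink d v v * (hexp' d x v t i - v i)"])
      (intro conjI hexp_geodesic[OF x v] hexp_parallel[OF x v u], simp_all add: hexp_geodesic[OF x v])
next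
  case (2 w)
  then obtain c c' V where g: "geodesic d c c'" and c01: "c 0 = x" "c 1 = hexp d x v 1"
    and V: "parallel_along d c V" and V01: "V 0 = u" "V 1 = w" by blast
  have c: "c t \<in> hyp d" if "t \<in> {0..1}" for t using g that by (auto simp: geodesic_def)
  have c'0: "c' 0 \<in> tangent d x" using g c01 by (auto simp: geodesic_def parallel_along_def)
  have e: "c t = hexp d x (c' 0) t" if "t \<in> {0..1}" for t
    by (rule geodesic_eq_hexp[OF g that, unfolded c01(1), THEN conjunct1])
  have "hexp d x (c' 0) 1 = hexp d x v 1"
    unfolding c01(2)[symmetric] by (rule e[symmetric]) simp
  note v' = hexp_inj[OF x c'0 v this]
  have eq: "c t = hexp d x v t" if "t \<in> {0..1}" for t
    by (rule e[OF that, unfolded v'])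
  have "parallel_along d c (\<lambda>t i. u i + mink d u v / mink d v v * (hexp' d x v t i - v i))"
    using hexp_parallel[OF x v u] by (simp add: parallel_along_def eq)
  from parallel_unique[OF c V this, of 1] show ?case
    using V01 hexp_geodesic(3)[OF x v] by auto
qed

lemma transport_eq:
  assumes x: "x \<in> hyp d" and y: "y \<in> hyp d" and u: "u \<in> tangent d x"
  shows "transport d x y u = (\<lambda>i. u i + mink d y u / (1 - mink d x y) * (x i + y i))"
proof -
  obtain v where v: "v \<in> tangent d x" and yv: "hexp d x v 1 = y"
    using geodesic_exists[OF x y] .
  let ?n = "tnorm d v"
  have xy: "mink d x y = - cosh ?n"
    unfolding yv[symmetric] hexp_def mink_combination
    using hypD(1)[OF x] tangentD[OF v] by simp
  have yu: "mink d y u = sinh ?n / ?n * mink d u v"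
    unfolding yv[symmetric] hexp_def mink_combination
    using tangentD[OF u] mink_commute[of d v u] by simp
  have "mink d u v / mink d v v * (hexp' d x v 1 i - v i) =
        mink d y u / (1 - mink d x y) * (x i + y i)" for i
  proof (cases "?n = 0")
    case True
    hence "v = (\<lambda>_. 0)" by (rule tnorm_eq_0[OF x v])
    hence "mink d u v = 0" by (simp add: mink_def)
    thus ?thesis by (simp add: yu)
  next
    case False
    have "1 + cosh ?n > 0" using cosh_real_pos[of ?n] by linarith
    hence nz: "1 + cosh ?n \<noteq> 0" by linarith
    have yi: "y i = cosh ?n * x i + sinh ?n / ?n * v i" by (simp add: hexp_def flip: yv)
    have "(hexp' d x v 1 i - v i) * (1 + cosh ?n) = sinh ?n * ?n * (x i + y i)"
    proof -
      have s: "sinh ?n * sinh ?n = (cosh ?n - 1) * (cosh ?n + 1)"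
        using cosh_sq_real[of ?n] by (simp add: algebra_simps power2_eq_square)
      have "sinh ?n * ?n * (x i + y i) =
          sinh ?n * ?n * (1 + cosh ?n) * x i + sinh ?n * sinh ?n * v i"
        using False by (simp add: yi algebra_simps)
      thus ?thesis unfolding s by (simp add: hexp'_def algebra_simps)
    qed
    hence "hexp' d x v 1 i - v i = sinh ?n * ?n * (x i + y i) / (1 + cosh ?n)"
      using nz by (simp add: eq_divide_eq)
    thus ?thesis
      using False nz unfolding yu xy tnorm_sq[OF x v, symmetric]
      by (simp add: power2_eq_square)
  qed
  with transport_hexp[OF x v u] yv show ?thesis by simp
qed

text \<open>
  Functions on \<open>hyp d\<close> are represented by functions on all of \<open>vec\<close>; only their values on \<open>hyp d\<close>
  are ever used.
\<close>

definition gconvex :: "nat \<Rightarrow> (vec \<Rightarrow> real) \<Rightarrow> bool" where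
  "gconvex d f \<longleftrightarrow>
     (\<forall>c c'. geodesic d c c' \<longrightarrow>
        (\<forall>t\<in>{0..1}. f (c t) \<le> (1 - t) * f (c 0) + t * f (c 1)))"

text \<open>
  Differentiability at \<open>x\<close> in normal coordinates: the point \<open>c 1\<close> below is the image of the initial
  velocity \<open>c' 0\<close> under the exponential map at \<open>x\<close>.
\<close>

definition has_gradient :: "nat \<Rightarrow> (vec \<Rightarrow> real) \<Rightarrow> vec \<Rightarrow> vec \<Rightarrow> bool" where
  "has_gradient d f x g \<longleftrightarrow> g \<in> tangent d x \<and>
     (\<forall>e>0. \<exists>s>0. \<forall>c c'. geodesic d c c' \<and> c 0 = x \<and> tnorm d (c' 0) < s \<longrightarrow>
        \<bar>f (c 1) - f x - mink d g (c' 0)\<bar> \<le> e * tnorm d (c' 0))"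

definition differentiable_hyp :: "nat \<Rightarrow> (vec \<Rightarrow> real) \<Rightarrow> bool" where
  "differentiable_hyp d f \<longleftrightarrow> (\<forall>x\<in>hyp d. \<exists>g. has_gradient d f x g)"

definition grad :: "nat \<Rightarrow> (vec \<Rightarrow> real) \<Rightarrow> vec \<Rightarrow> vec" where
  "grad d f x = (THE g. has_gradient d f x g)"

lemma grad_eq:
  assumes x: "x \<in> hyp d" and g: "has_gradient d f x g"
  shows "grad d f x = g"
  unfolding grad_def
proof (rule the_equality[where a = g], rule g)
  fix h assume h: "has_gradient d f x h"
  define w where "w = (\<lambda>i. g i - h i)"
  define n where "n = tnorm d w"
  have w: "w \<in> tangent d x"
    using g h by (simp add: has_gradient_def tangent_def minkowski_space_def w_def mink_linear)
  have "n = 0"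
  proof (rule ccontr)
    assume "n \<noteq> 0"
    hence n: "n > 0" using tnorm_nonneg[OF x w] by (simp add: n_def)
    hence e: "n / 4 > 0" by simp
    obtain s where s: "s > 0" "\<And>c c'. geodesic d c c' \<Longrightarrow> c 0 = x \<Longrightarrow> tnorm d (c' 0) < s \<Longrightarrow>
        \<bar>f (c 1) - f x - mink d g (c' 0)\<bar> \<le> n / 4 * tnorm d (c' 0)"
      using g e unfolding has_gradient_def by blast
    obtain r where r: "r > 0" "\<And>c c'. geodesic d c c' \<Longrightarrow> c 0 = x \<Longrightarrow> tnorm d (c' 0) < r \<Longrightarrow>
        \<bar>f (c 1) - f x - mink d h (c' 0)\<bar> \<le> n / 4 * tnorm d (c' 0)"
      using h e unfolding has_gradient_def by blast
    define a where "a = min s r / (2 * n)"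
    define v where "v = (\<lambda>i. a * w i)"
    have a: "a > 0" using s(1) r(1) n by (simp add: a_def)
    have v: "v \<in> tangent d x"
      using w unfolding v_def by (simp add: tangent_def minkowski_space_def mink_scale_right)
    have nv: "tnorm d v = a * n" unfolding v_def tnorm_scale n_def using a by simp
    also have "\<dots> = min s r / 2" using n by (simp add: a_def)
    finally have sm: "tnorm d v < s" "tnorm d v < r" using s(1) r(1) by auto
    note E = hexp_geodesic[OF x v]
    have "\<bar>mink d g v - mink d h v\<bar> \<le> 2 * (n / 4 * (a * n))"
      using s(2)[OF E(1,2)] r(2)[OF E(1,2)] sm unfolding E(3) nv by linarith
    also have "mink d g v - mink d h v = a * mink d w w"
      unfolding v_def mink_scale_right w_def mink_diff_left by (simp add: algebra_simps)
    also have "mink d w w = n\<^sup>2" using tnorm_sq[OF x w] by (simp add: n_def)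
    finally have "a * n\<^sup>2 \<le> a * n\<^sup>2 / 2" using a by (simp add: power2_eq_square)
    moreover have "a * n\<^sup>2 > 0" using a n by simp
    ultimately show False by linarith
  qed
  hence "w = (\<lambda>_. 0)" using tnorm_eq_0[OF x w] by (simp add: n_def)
  thus "h = g" by (auto simp: w_def fun_eq_iff)
qed

definition L_smooth :: "nat \<Rightarrow> real \<Rightarrow> (vec \<Rightarrow> real) \<Rightarrow> bool" where
  "L_smooth d L f \<longleftrightarrow> differentiable_hyp d f \<and>
     (\<forall>x\<in>hyp d. \<forall>y\<in>hyp d.
        tnorm d (\<lambda>i. grad d f x i - transport d y x (grad d f y) i) \<le> L * hdist d x y)"

definition global_minimizer :: "nat \<Rightarrow> (vec \<Rightarrow> real) \<Rightarrow> vec \<Rightarrow> bool" where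
  "global_minimizer d f x \<longleftrightarrow> x \<in> hyp d \<and> (\<forall>y\<in>hyp d. f x \<le> f y)"

text \<open>Only used for functions that have a global minimizer, where the infimum is the minimum.\<close>

definition fmin :: "nat \<Rightarrow> (vec \<Rightarrow> real) \<Rightarrow> real" where
  "fmin d f = (INF x\<in>hyp d. f x)"

text \<open>\<open>xref d\<close> is the reference point of the \<open>d\<close>-dimensional space.\<close>

definition smooth_class_dim :: "(nat \<Rightarrow> vec) \<Rightarrow> nat \<Rightarrow> real \<Rightarrow> real \<Rightarrow> (vec \<Rightarrow> real) set" where
  "smooth_class_dim xref d r L =
     {f. gconvex d f \<and> L_smooth d L f \<and> (\<exists>x\<in>hball d (xref d) r. global_minimizer d f x)}"

definition smooth_class :: "(nat \<Rightarrow> vec) \<Rightarrow> real \<Rightarrow> real \<Rightarrow> (nat \<times> (vec \<Rightarrow> real)) set" where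
  "smooth_class xref r L = (SIGMA d:{2..}. smooth_class_dim xref d r L)"

text \<open>
  A sequence of maps \<open>A\<^sub>k\<close> on \<open>k\<close>-tuples of observations (function value, query point, gradient),
  \<open>k \<ge> 0\<close>, is the same as one map on lists of observations, the oldest observation first.  The
  first argument of an algorithm is the dimension.
\<close>

type_synonym observation = "real \<times> (vec \<times> vec)"
type_synonym algorithm = "nat \<Rightarrow> observation list \<Rightarrow> vec"

definition first_order_algorithm :: "algorithm \<Rightarrow> bool" where
  "first_order_algorithm A \<longleftrightarrow>
     (\<forall>d\<ge>2. \<forall>h\<in>lists (UNIV \<times> tangent_bundle d). A d h \<in> hyp d)"

fun history :: "algorithm \<Rightarrow> nat \<Rightarrow> (vec \<Rightarrow> real) \<Rightarrow> nat \<Rightarrow> observation list" where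
  "history A d f 0 = []"
| "history A d f (Suc k) =
     (let h = history A d f k; x = A d h in h @ [(f x, (x, grad d f x))])"

definition query :: "algorithm \<Rightarrow> nat \<Rightarrow> (vec \<Rightarrow> real) \<Rightarrow> nat \<Rightarrow> vec" where
  "query A d f k = A d (history A d f k)"

text \<open>The value is \<open>\<infinity>\<close>, the infimum of the empty set, if the accuracy is never reached.\<close>

definition query_complexity :: "algorithm \<Rightarrow> nat \<Rightarrow> (vec \<Rightarrow> real) \<Rightarrow> real \<Rightarrow> enat" where
  "query_complexity A d f \<delta> =
     (INF k\<in>{k. f (query A d f k) - fmin d f \<le> \<delta>}. enat k)"

definition zeta :: "real \<Rightarrow> real" where
  "zeta r = r / tanh r"

end

theory Submission
  imports Defs
begin

text \<open>
  The hard function is a hyperbolic version of Nesterov's chain,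
  \<open>f x = L/2 * ln (1 + A(x,x))\<close> with \<open>A(x,x) = \<Sum>\<^sub>i \<langle>n\<^sub>i,x\<rangle>\<^sup>2\<close>, where \<open>n\<^sub>i = (g\<^sub>i - g\<^sub>i\<^sub>+\<^sub>1)/2\<close>, \<open>g\<^sub>0 = -c p\<close> for the
  reference point \<open>p\<close>, and \<open>g\<^sub>1, \<dots>, g\<^sub>T\<close> are orthonormal in the tangent space at \<open>p\<close>.
  On the hyperboloid \<open>1 + A(x,x)\<close> is the restriction of the homogeneous quadratic form
  \<open>A(x,x) - \<langle>x,x\<rangle>\<close>.  Whenever \<open>A(w,w) \<le> \<langle>w,w\<rangle>\<close> on the tangent space at a single point, the Hessian of half
  the logarithm of this form lies between \<open>0\<close> and the metric at every point, so \<open>f\<close> is g-convex and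
  \<open>L\<close>-smooth.  With \<open>c = tanh r / sqrt T\<close> the form \<open>A\<close> vanishes at a point at distance \<open>r\<close> from \<open>p\<close>.
  The vectors \<open>g\<^sub>i\<close> are chosen adversarially: \<open>g\<^sub>k\<^sub>+\<^sub>1\<close> is orthogonal to the queries \<open>x\<^sub>0, \<dots>, x\<^sub>k\<close>, so the
  numbers \<open>\<langle>g\<^sub>i,x\<^sub>k\<rangle>\<close> drop from at least \<open>c\<close> to \<open>0\<close> within \<open>T\<close> steps, which forces
  \<open>A(x\<^sub>k,x\<^sub>k) \<ge> c\<^sup>2 / (4 T)\<close>.
\<close>

section \<open>Calculus along curves\<close>

lemma mean_value_within:
  fixes h h' :: "real \<Rightarrow> real"
  assumes "\<And>t. t \<in> {0..1} \<Longrightarrow> (h has_real_derivative h' t) (at t within {0..1})"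
    and "0 \<le> a" "a < b" "b \<le> 1"
  shows "\<exists>\<xi>\<in>{a<..<b}. h b - h a = (b - a) * h' \<xi>"
proof -
  have "(h has_derivative (*) (h' x)) (at x within {a..b})" if "a \<le> x" "x \<le> b" for x
  proof -
    have "(h has_real_derivative h' x) (at x within {a..b})"
      by (rule DERIV_subset[OF assms(1)]) (use assms that in auto)
    thus ?thesis by (simp add: has_field_derivative_def)
  qed
  from mvt_simple[OF \<open>a < b\<close> this] show ?thesis by (auto simp: mult.commute)
qed

text \<open>The mean slopes on the two sides of \<open>t\<close> are values of
  \<open>\<phi>'\<close> at points \<open>a < b\<close>, and a third mean value orders them.\<close>

lemma convex_of_increasing_derivative:
  fixes \<phi> \<phi>' h' :: "real \<Rightarrow> real"
  assumes d1: "\<And>t. t \<in> {0..1} \<Longrightarrow> (\<phi> has_real_derivative \<phi>' t) (at t within {0..1})"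
    and d2: "\<And>t. t \<in> {0..1} \<Longrightarrow> (\<phi>' has_real_derivative h' t) (at t within {0..1})"
    and pos: "\<And>t. t \<in> {0..1} \<Longrightarrow> h' t \<ge> 0" and t: "t \<in> {0..1}"
  shows "\<phi> t \<le> (1 - t) * \<phi> 0 + t * \<phi> 1"
proof (cases "t = 0 \<or> t = 1")
  case False
  with t have t: "0 < t" "t < 1" by auto
  obtain a where a: "a \<in> {0<..<t}" "\<phi> t - \<phi> 0 = t * \<phi>' a"
    using mean_value_within[of \<phi> \<phi>' 0 t, OF d1] t by auto
  obtain b where b: "b \<in> {t<..<1}" "\<phi> 1 - \<phi> t = (1 - t) * \<phi>' b"
    using mean_value_within[of \<phi> \<phi>' t 1, OF d1] t by auto
  obtain s where s: "s \<in> {a<..<b}" "\<phi>' b - \<phi>' a = (b - a) * h' s"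
    using mean_value_within[of \<phi>' h' a b, OF d2] a b by auto
  have "(b - a) * h' s \<ge> 0" using s a b pos[of s] by (intro mult_nonneg_nonneg) auto
  hence "\<phi>' a \<le> \<phi>' b" using s(2) by linarith
  hence "t * (1 - t) * \<phi>' a \<le> t * (1 - t) * \<phi>' b"
    using t by (intro mult_left_mono) auto
  hence "(1 - t) * (\<phi> t - \<phi> 0) \<le> t * (\<phi> 1 - \<phi> t)"
    unfolding a b by (simp add: algebra_simps)
  thus ?thesis by (simp add: algebra_simps)
qed auto

text \<open>Discriminant of a nonnegative quadratic polynomial in \<open>s\<close>: for
  \<open>C > 0\<close> its minimiser \<open>- B / C\<close> is inserted; for \<open>C = 0\<close> it
  is affine and bounded below, hence constant.\<close>

lemma psd_cauchy_schwarz: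
  fixes A B C :: real
  assumes "\<And>s. A + 2 * s * B + s\<^sup>2 * C \<ge> 0" and "C \<ge> 0"
  shows "B\<^sup>2 \<le> A * C"
proof (cases "C = 0")
  case True
  have "B = 0"
  proof (rule ccontr)
    assume "B \<noteq> 0"
    hence "A + 2 * (- (A + 1) / (2 * B)) * B = - 1" by (simp add: field_simps)
    with assms(1)[of "- (A + 1) / (2 * B)"] True show False by simp
  qed
  with True show ?thesis by simp
next
  case False
  with assms(2) have C: "C > 0" by simp
  have "A + 2 * (- B / C) * B + (- B / C)\<^sup>2 * C = A - B\<^sup>2 / C"
    using C by (simp add: power2_eq_square field_simps)
  with assms(1)[of "- B / C"] have "B\<^sup>2 / C \<le> A" by linarith
  with C show ?thesis by (simp add: divide_le_eq)
qed

lemma has_velocity_mink_left: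
  assumes "has_velocity c c' t"
  shows "((\<lambda>s. mink d a (c s)) has_real_derivative mink d a c') (at t within {0..1})"
proof -
  have "has_velocity (\<lambda>_. a) (\<lambda>_. 0) t" by (simp add: has_velocity_def)
  from mink_has_derivative[OF this assms, of d] show ?thesis by (simp add: mink_def)
qed

text \<open>The ambient derivatives of \<open>U\<close> and \<open>W\<close> are multiples of the
  base point, hence orthogonal to tangent vectors, and the product rule leaves nothing. This is how
  parallel fields keep their inner products.\<close>

lemma mink_normal_velocities_constant:
  assumes "\<And>t. t \<in> {0..1} \<Longrightarrow> U t \<in> tangent d (c t)"
    and "\<And>t. t \<in> {0..1} \<Longrightarrow> W t \<in> tangent d (c t)"
    and "\<And>t. t \<in> {0..1} \<Longrightarrow> has_velocity U (\<lambda>i. k * c t i) t"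
    and "\<And>t. t \<in> {0..1} \<Longrightarrow> has_velocity W (\<lambda>i. l * c t i) t"
    and t: "t \<in> {0..1}"
  shows "mink d (U t) (W t) = mink d (U 0) (W 0)"
proof (rule constant_on_unit_interval[OF _ t])
  fix s :: real assume s: "s \<in> {0..1}"
  from mink_has_derivative[OF assms(3,4)[OF s], of d]
  show "((\<lambda>s. mink d (U s) (W s)) has_real_derivative 0) (at s within {0..1})"
    using tangentD[OF assms(1)[OF s]] tangentD[OF assms(2)[OF s]]
    by (simp add: mink_scale_left mink_scale_right)
qed

section \<open>The logarithm of a quadratic form\<close>

definition gram :: "nat \<Rightarrow> (nat \<Rightarrow> vec) \<Rightarrow> nat \<Rightarrow> vec \<Rightarrow> vec \<Rightarrow> real" where
  "gram d n m x y = (\<Sum>i<m. mink d (n i) x * mink d (n i) y)"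

definition log_gram :: "real \<Rightarrow> nat \<Rightarrow> (nat \<Rightarrow> vec) \<Rightarrow> nat \<Rightarrow> vec \<Rightarrow> real" where
  "log_gram L d n m x = L / 2 * ln (1 + gram d n m x x)"

text \<open>The Minkowski gradient of \<open>log_gram\<close> in the ambient space plus the multiple
  of \<open>x\<close> that projects it to the tangent space; the coefficient comes from
  \<open>mink d x x = -1\<close>.\<close>

definition log_gram_grad :: "real \<Rightarrow> nat \<Rightarrow> (nat \<Rightarrow> vec) \<Rightarrow> nat \<Rightarrow> vec \<Rightarrow> vec" where
  "log_gram_grad L d n m x =
     (\<lambda>k. L / (1 + gram d n m x x) *
            ((\<Sum>i<m. mink d (n i) x * n i k) + gram d n m x x * x k))"

text \<open>The covariant Hessian of \<open>log_gram\<close> without the factor \<open>L\<close>.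
  The term with \<open>mink d v u\<close> stems from the normal acceleration of geodesics in the
  ambient space.\<close>

definition log_gram_hess :: "nat \<Rightarrow> (nat \<Rightarrow> vec) \<Rightarrow> nat \<Rightarrow> vec \<Rightarrow> vec \<Rightarrow> vec \<Rightarrow> real" where
  "log_gram_hess d n m x v u =
     (gram d n m v u + mink d v u * gram d n m x x) / (1 + gram d n m x x) -
     2 * gram d n m x v * gram d n m x u / (1 + gram d n m x x)\<^sup>2"

lemma gram_commute: "gram d n m x y = gram d n m y x"
  by (simp add: gram_def mult.commute)

lemma gram_add_right: "gram d n m x (\<lambda>i. y i + z i) = gram d n m x y + gram d n m x z"
  by (simp add: gram_def mink_add_right algebra_simps sum.distrib)

lemma gram_scale_right: "gram d n m x (\<lambda>i. a * y i) = a * gram d n m x y"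
  by (simp add: gram_def mink_scale_right algebra_simps sum_distrib_left)

lemma gram_add_left: "gram d n m (\<lambda>i. y i + z i) x = gram d n m y x + gram d n m z x"
  by (simp add: gram_commute[of d n m _ x] gram_add_right)

lemma gram_scale_left: "gram d n m (\<lambda>i. a * y i) x = a * gram d n m y x"
  by (simp add: gram_commute[of d n m _ x] gram_scale_right)

lemmas gram_linear = gram_add_right gram_scale_right gram_add_left gram_scale_left

lemma gram_nonneg: "gram d n m x x \<ge> 0"
  by (simp add: gram_def sum_nonneg)

lemma one_plus_gram_pos: "1 + gram d n m x x > 0"
  using gram_nonneg[of d n m x] by linarith

lemma gram_cauchy_schwarz: "(gram d n m x y)\<^sup>2 \<le> gram d n m x x * gram d n m y y"
  unfolding gram_def power2_eq_square[symmetric] by (rule Cauchy_Schwarz_ineq_sum)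

lemma gram_has_derivative:
  assumes "has_velocity a a' t" "has_velocity b b' t"
  shows "((\<lambda>s. gram d n m (a s) (b s)) has_real_derivative
           (gram d n m a' (b t) + gram d n m (a t) b')) (at t within {0..1})"
  unfolding gram_def
  by (rule derivative_eq_intros has_velocity_mink_left[OF assms(1)]
        has_velocity_mink_left[OF assms(2)] refl)+
    (simp add: sum.distrib algebra_simps)

lemma mink_sum_right: "mink d x (\<lambda>k. \<Sum>i\<in>I. g i * y i k) = (\<Sum>i\<in>I. g i * mink d x (y i))"
proof (induction I rule: infinite_finite_induct)
  case (insert i I)
  then show ?case by (simp add: mink_add_right mink_scale_right)
qed (simp_all add: mink_def)

lemma mink_log_gram_grad:
  assumes "mink d x u = 0"
  shows "mink d (log_gram_grad L d n m x) u = L * gram d n m x u / (1 + gram d n m x x)"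
proof -
  have "mink d u (log_gram_grad L d n m x) =
      L / (1 + gram d n m x x) * ((\<Sum>i<m. mink d (n i) x * mink d u (n i)) + gram d n m x x * mink d u x)"
    unfolding log_gram_grad_def mink_scale_right mink_add_right mink_sum_right ..
  thus ?thesis using assms by (simp add: gram_def mink_commute[of d u])
qed

lemma one_plus_gram_has_derivative:
  assumes "has_velocity c c' t"
  shows "((\<lambda>s. 1 + gram d n m (c s) (c s)) has_real_derivative
           2 * gram d n m (c t) c') (at t within {0..1})"
proof -
  have "((\<lambda>s. gram d n m (c s) (c s)) has_real_derivative
      gram d n m c' (c t) + gram d n m (c t) c') (at t within {0..1})"
    by (rule gram_has_derivative[OF assms assms])
  from DERIV_add[OF DERIV_const[of 1] this] show ?thesis
    by (simp add: gram_commute[of d n m c'])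
qed

lemma log_gram_has_derivative:
  assumes "has_velocity c c' t"
  shows "((\<lambda>s. log_gram L d n m (c s)) has_real_derivative
           L * gram d n m (c t) c' / (1 + gram d n m (c t) (c t))) (at t within {0..1})"
proof -
  from DERIV_cmult[OF DERIV_chain2[OF DERIV_ln_divide[OF one_plus_gram_pos[of d n m "c t"]]
        one_plus_gram_has_derivative[OF assms]], where c = "L / 2"]
  show ?thesis unfolding log_gram_def by simp
qed

text \<open>The assumption on \<open>U\<close> is the equation of parallel transport along
  \<open>c\<close>. Taking the velocity of a geodesic for \<open>U\<close> gives the second
  derivative needed for convexity; a general parallel field gives the mixed one needed for
  smoothness.\<close>

lemma log_gram_second_derivative:
  assumes c: "has_velocity c c' t" and U: "has_velocity U (\<lambda>i. mink d c' (U t) * c t i) t"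
  shows "((\<lambda>s. L * gram d n m (c s) (U s) / (1 + gram d n m (c s) (c s))) has_real_derivative
           L * log_gram_hess d n m (c t) c' (U t)) (at t within {0..1})"
proof -
  have q: "1 + gram d n m (c t) (c t) \<noteq> 0" using one_plus_gram_pos[of d n m "c t"] by simp
  have scalar: "L * ((g + k * a) / q - 2 * z * y / q\<^sup>2) =
      (L * (g + k * a) * q - L * y * (2 * z)) / (q * q)" if "q \<noteq> 0" for g k a q z y :: real
    using that by (simp add: power2_eq_square divide_simps) (simp add: algebra_simps)
  have "((\<lambda>s. L * gram d n m (c s) (U s)) has_real_derivative
      L * (gram d n m c' (U t) + mink d c' (U t) * gram d n m (c t) (c t))) (at t within {0..1})"
    using DERIV_cmult[OF gram_has_derivative[OF c U], where c = L] by (simp add: gram_scale_right)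
  from DERIV_divide[OF this one_plus_gram_has_derivative[OF c] q] show ?thesis
    unfolding log_gram_hess_def scalar[OF q] .
qed

lemma log_gram_hess_numerator:
  "(1 + gram d n m x x)\<^sup>2 * log_gram_hess d n m x v u =
     (gram d n m v u + mink d v u * gram d n m x x) * (1 + gram d n m x x) -
     2 * gram d n m x v * gram d n m x u"
proof -
  have scalar: "q\<^sup>2 * (g / q - y / q\<^sup>2) = g * q - y" if "q \<noteq> 0" for g q y :: real
    using that by (simp add: right_diff_distrib power2_eq_square)
  show ?thesis
    unfolding log_gram_hess_def by (rule scalar) (use one_plus_gram_pos[of d n m x] in simp)
qed

text \<open>The two bounds on the Hessian in scalar form: \<open>a = A(x,x)\<close>, \<open>y = A(x,w)\<close>, \<open>W = A(w,w)\<close> where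
  \<open>v = \<tau> x + w\<close> is a tangent vector at \<open>x\<close> with \<open>N = \<langle>v,v\<rangle>\<close>, and \<open>w\<close> is tangent at the reference point.\<close>

lemma hess_numerator_bounds:
  fixes a W N \<tau> y :: real
  assumes a: "a \<ge> 0" and W: "W \<ge> 0" "W + \<tau>\<^sup>2 \<le> N" and y: "y\<^sup>2 \<le> a * W"
  defines "E \<equiv> (\<tau>\<^sup>2 * a + 2 * \<tau> * y + W + N * a) * (1 + a) - 2 * (\<tau> * a + y)\<^sup>2"
  shows "0 \<le> E" "E \<le> (1 + a)\<^sup>2 * N"
proof -
  have E: "E = N * a * (1 + a) + W * (1 + a) + \<tau>\<^sup>2 * a * (1 - a) + 2 * \<tau> * y * (1 - a) - 2 * y\<^sup>2"
    by (simp add: E_def power2_eq_square algebra_simps)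
  have "N * (1 + a) \<ge> (W + \<tau>\<^sup>2) * (1 + a)" using W a by (intro mult_right_mono) auto
  \<comment> \<open>Once \<open>N * (1 + a)\<close> is replaced by its lower bound,
    \<open>(1 + a)^2 * N - E\<close> is exactly this sum of nonnegative terms.\<close>
  moreover have "(\<tau> * (1 - a) - y)\<^sup>2 + y\<^sup>2 + 2 * a * \<tau>\<^sup>2 \<ge> 0" using a by simp
  ultimately show "E \<le> (1 + a)\<^sup>2 * N"
    unfolding E by (simp add: power2_eq_square algebra_simps)
  \<comment> \<open>The mixed term is absorbed by the arithmetic-geometric mean inequality. What
    then remains below \<open>E\<close> is \<open>4 * a * W + a * \<tau>^2 - 2 * y^2\<close>, which
    is nonnegative by the bound on \<open>y\<close>.\<close>
  have "\<bar>y\<bar> \<le> sqrt a * sqrt W"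
    using y real_sqrt_le_mono[OF y] by (simp add: real_sqrt_mult)
  hence "\<bar>\<tau> * (1 - a)\<bar> * \<bar>y\<bar> \<le> \<bar>\<tau> * (1 - a)\<bar> * (sqrt a * sqrt W)" by (rule mult_left_mono) simp
  hence 1: "\<bar>\<tau> * y * (1 - a)\<bar> \<le> (\<bar>\<tau>\<bar> * sqrt a) * (\<bar>1 - a\<bar> * sqrt W)"
    by (simp add: abs_mult mult_ac)
  have "0 \<le> (\<bar>\<tau>\<bar> * sqrt a - \<bar>1 - a\<bar> * sqrt W)\<^sup>2" by simp
  also have "\<dots> = \<tau>\<^sup>2 * a + (1 - a)\<^sup>2 * W - 2 * ((\<bar>\<tau>\<bar> * sqrt a) * (\<bar>1 - a\<bar> * sqrt W))"
    using a W by (simp add: power2_diff power_mult_distrib)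
  finally have 2: "2 * \<tau> * y * (1 - a) \<ge> - (\<tau>\<^sup>2 * a + (1 - a)\<^sup>2 * W)" using 1 by linarith
  have "N * (a * (1 + a)) \<ge> (W + \<tau>\<^sup>2) * (a * (1 + a))" using W a by (intro mult_right_mono) auto
  moreover have "a * \<tau>\<^sup>2 \<ge> 0" "a * W \<ge> 0" using a W by simp_all
  ultimately show "0 \<le> E"
    unfolding E using 2 y by (simp add: power2_eq_square algebra_simps)
qed

section \<open>Bounds on the Hessian from contraction at one point\<close>

locale contractive_gram =
  fixes d :: nat and n :: "nat \<Rightarrow> vec" and m :: nat and p :: vec
  assumes p: "p \<in> hyp d"
    and n_amb: "\<And>i. i < m \<Longrightarrow> n i \<in> minkowski_space d"
    and contraction: "\<And>w. w \<in> tangent d p \<Longrightarrow> gram d n m w w \<le> mink d w w"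
begin

text \<open>Contraction is known only at \<open>p\<close>, so \<open>v\<close> is split as
  \<open>\<tau> * x + w\<close> with \<open>w\<close> tangent at \<open>p\<close>; the condition
  \<open>mink d p w = 0\<close> determines \<open>\<tau>\<close>. As \<open>x\<close> and
  \<open>v\<close> are orthogonal, \<open>mink d w w = mink d v v - \<tau>^2\<close>, and the scalar
  estimates apply.\<close>

lemma log_gram_hess_bounds:
  assumes x: "x \<in> hyp d" and v: "v \<in> tangent d x"
  shows "0 \<le> log_gram_hess d n m x v v" "log_gram_hess d n m x v v \<le> mink d v v"
proof -
  define \<tau> where "\<tau> = mink d p v / mink d p x"
  define w where "w = (\<lambda>i. v i + - \<tau> * x i)"
  define a where "a = gram d n m x x"
  define W where "W = gram d n m w w"
  define y where "y = gram d n m x w"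
  have px: "mink d p x \<noteq> 0" using mink_hyp_le[OF p x] by auto
  have w: "w \<in> tangent d p"
    unfolding tangent_def
  proof (intro CollectI conjI)
    show "w \<in> minkowski_space d"
      using hypD(3)[OF x] tangentD(3)[OF v] by (simp add: w_def minkowski_space_def)
    show "mink d p w = 0"
      unfolding w_def mink_add_right mink_scale_right using px by (simp add: \<tau>_def)
  qed
  have "mink d w w = mink d v v - \<tau>\<^sup>2"
    unfolding w_def mink_add_right mink_scale_right mink_add_left mink_scale_left
    using hypD(1)[OF x] tangentD[OF v] by (simp add: power2_eq_square)
  hence W: "W + \<tau>\<^sup>2 \<le> mink d v v" using contraction[OF w] by (simp add: W_def)
  have v_eq: "v = (\<lambda>i. \<tau> * x i + w i)" by (simp add: w_def)
  have xv: "gram d n m x v = \<tau> * a + y"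
    by (subst v_eq) (simp only: gram_linear a_def y_def)
  have vv: "gram d n m v v = \<tau>\<^sup>2 * a + 2 * \<tau> * y + W"
    by (subst (1 2) v_eq)
      (simp add: gram_linear gram_commute[of d n m w x] a_def y_def W_def power2_eq_square algebra_simps)
  have num: "(1 + a)\<^sup>2 * log_gram_hess d n m x v v =
      (\<tau>\<^sup>2 * a + 2 * \<tau> * y + W + mink d v v * a) * (1 + a) - 2 * (\<tau> * a + y)\<^sup>2"
    using log_gram_hess_numerator[of d n m x v v]
    by (simp add: xv vv power2_eq_square flip: a_def)
  have a: "a \<ge> 0" "W \<ge> 0" "y\<^sup>2 \<le> a * W"
    by (simp_all add: a_def W_def y_def gram_nonneg gram_cauchy_schwarz)
  have q: "(1 + a)\<^sup>2 > 0" using a by simp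
  note * = hess_numerator_bounds[OF a(1,2) W a(3), folded num]
  show "0 \<le> log_gram_hess d n m x v v" using *(1) q by (simp add: zero_le_mult_iff)
  show "log_gram_hess d n m x v v \<le> mink d v v" using *(2) q by (simp add: mult_le_cancel_left)
qed

text \<open>Cauchy-Schwarz for the nonnegative form \<open>log_gram_hess\<close> turns the bounds on
  its diagonal into a bound on its operator norm.\<close>

lemma log_gram_hess_abs_le:
  assumes x: "x \<in> hyp d" and v: "v \<in> tangent d x" and u: "u \<in> tangent d x"
  shows "\<bar>log_gram_hess d n m x v u\<bar> \<le> tnorm d v * tnorm d u"
proof -
  let ?H = "log_gram_hess d n m x"
  have "(?H v u)\<^sup>2 \<le> ?H v v * ?H u u"
  proof (rule psd_cauchy_schwarz[OF _ log_gram_hess_bounds(1)[OF x u]])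
    fix s
    have t: "(\<lambda>i. v i + s * u i) \<in> tangent d x"
      using v u by (simp add: tangent_def minkowski_space_def mink_add_right mink_scale_right)
    have "?H (\<lambda>i. v i + s * u i) (\<lambda>i. v i + s * u i) = ?H v v + 2 * s * ?H v u + s\<^sup>2 * ?H u u"
      using one_plus_gram_pos[of d n m x]
      by (simp add: log_gram_hess_def gram_linear mink_linear gram_commute[of d n m u v]
          mink_commute[of d u v] add_divide_distrib diff_divide_distrib power2_eq_square algebra_simps)
    with log_gram_hess_bounds(1)[OF x t] show "0 \<le> ?H v v + 2 * s * ?H v u + s\<^sup>2 * ?H u u" by simp
  qed
  also have "\<dots> \<le> mink d v v * mink d u u"
    by (intro mult_mono log_gram_hess_bounds x v u mink_tangent_nonneg[OF x v])
  also have "\<dots> = (tnorm d v * tnorm d u)\<^sup>2"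
    by (simp add: power_mult_distrib tnorm_sq[OF x v] tnorm_sq[OF x u])
  finally have "\<bar>?H v u\<bar>\<^sup>2 \<le> (tnorm d v * tnorm d u)\<^sup>2" by simp
  thus ?thesis by (rule power2_le_imp_le) (simp add: tnorm_nonneg[OF x v] tnorm_nonneg[OF x u])
qed

lemma log_gram_grad_tangent:
  assumes x: "x \<in> hyp d"
  shows "log_gram_grad L d n m x \<in> tangent d x"
proof -
  have "mink d x (log_gram_grad L d n m x) = L / (1 + gram d n m x x) *
      ((\<Sum>i<m. mink d (n i) x * mink d x (n i)) + gram d n m x x * mink d x x)"
    unfolding log_gram_grad_def mink_scale_right mink_add_right mink_sum_right ..
  also have "\<dots> = 0" by (simp add: hypD(1)[OF x] gram_def mink_commute[of d x "n _"])
  finally show ?thesis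
    using n_amb hypD(3)[OF x] by (simp add: tangent_def minkowski_space_def log_gram_grad_def)
qed

lemma hexp'_norm:
  assumes x: "x \<in> hyp d" and v: "v \<in> tangent d x" and t: "t \<in> {0..1}"
  shows "mink d (hexp' d x v t) (hexp' d x v t) = mink d v v"
  using mink_normal_velocities_constant[where U = "hexp' d x v" and W = "hexp' d x v",
      OF hexp'_tangent[OF x v] hexp'_tangent[OF x v] hexp_has_velocity(2)[OF x v]
        hexp_has_velocity(2)[OF x v] t]
  by (simp add: hexp_geodesic(3)[OF x v])

lemma second_derivative_along_geodesic:
  assumes x: "x \<in> hyp d" and v: "v \<in> tangent d x" and t: "t \<in> {0..1}"
  defines "c \<equiv> hexp d x v" and "c' \<equiv> hexp' d x v"
  shows "((\<lambda>s. L * gram d n m (c s) (c' s) / (1 + gram d n m (c s) (c s))) has_real_derivative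
           L * log_gram_hess d n m (c t) (c' t) (c' t)) (at t within {0..1})"
  \<comment> \<open>Constant speed identifies the acceleration factor \<open>mink d v v\<close> with
    \<open>mink d (c' t) (c' t)\<close>, so the velocity is a parallel field in the required
    form.\<close>
  unfolding c_def c'_def
  by (rule log_gram_second_derivative[OF hexp_has_velocity(1)[OF x v]])
    (use hexp_has_velocity(2)[OF x v, of t] hexp'_norm[OF x v t] in simp)

section \<open>Convexity, gradient and smoothness\<close>

lemma gconvex_log_gram:
  assumes L: "L \<ge> 0"
  shows "gconvex d (log_gram L d n m)"
  unfolding gconvex_def
proof (intro allI impI ballI)
  fix c c' t assume g: "geodesic d c c'" and t: "t \<in> {0..1::real}"
  define x v where "x = c 0" and "v = c' 0"
  have x: "x \<in> hyp d" and v: "v \<in> tangent d x"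
    using g by (auto simp: geodesic_def parallel_along_def x_def v_def)
  have c: "c s = hexp d x v s" if "s \<in> {0..1}" for s
    using geodesic_eq_hexp[OF g that] by (simp add: x_def v_def)
  have "log_gram L d n m (hexp d x v t) \<le>
      (1 - t) * log_gram L d n m (hexp d x v 0) + t * log_gram L d n m (hexp d x v 1)"
    by (rule convex_of_increasing_derivative[OF
          log_gram_has_derivative[OF hexp_has_velocity(1)[OF x v]]
          second_derivative_along_geodesic[OF x v] _ t])
      (auto intro!: mult_nonneg_nonneg L log_gram_hess_bounds(1) hexp_in_hyp[OF x v] hexp'_tangent[OF x v])
  thus "log_gram L d n m (c t) \<le> (1 - t) * log_gram L d n m (c 0) + t * log_gram L d n m (c 1)"
    using t by (simp add: c)
qed

text \<open>Two mean values and the upper Hessian bound show that the first-order remainder is at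
  most \<open>L\<close> times the squared length of the initial velocity; hence the radius
  \<open>e / L\<close>.\<close>

lemma has_gradient_log_gram:
  assumes x: "x \<in> hyp d" and L: "L > 0"
  shows "has_gradient d (log_gram L d n m) x (log_gram_grad L d n m x)"
  unfolding has_gradient_def
proof (intro conjI allI impI log_gram_grad_tangent[OF x])
  fix e :: real assume e: "e > 0"
  show "\<exists>s>0. \<forall>c c'. geodesic d c c' \<and> c 0 = x \<and> tnorm d (c' 0) < s \<longrightarrow>
      \<bar>log_gram L d n m (c 1) - log_gram L d n m x - mink d (log_gram_grad L d n m x) (c' 0)\<bar>
        \<le> e * tnorm d (c' 0)"
  proof (intro exI conjI allI impI)
    show "e / L > 0" using e L by simp
    fix c c' assume "geodesic d c c' \<and> c 0 = x \<and> tnorm d (c' 0) < e / L"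
    hence g: "geodesic d c c'" and c0: "c 0 = x" and small: "tnorm d (c' 0) < e / L" by auto
    define v where "v = c' 0"
    have v: "v \<in> tangent d x"
      using g c0 by (auto simp: geodesic_def parallel_along_def v_def)
    have c1: "c 1 = hexp d x v 1" using geodesic_eq_hexp[OF g, of 1] by (simp add: c0 v_def)
    let ?c = "hexp d x v" and ?c' = "hexp' d x v"
    let ?h = "\<lambda>s. L * gram d n m (?c s) (?c' s) / (1 + gram d n m (?c s) (?c s))"
    obtain a where a: "a \<in> {0<..<1}"
      "log_gram L d n m (?c 1) - log_gram L d n m (?c 0) = (1 - 0) * ?h a"
      using mean_value_within[OF log_gram_has_derivative[OF hexp_has_velocity(1)[OF x v]], of 0 1]
      by (metis order_refl zero_less_one)
    have a01: "0 < a" "a < 1" using a by auto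
    obtain b where b: "b \<in> {0<..<a}"
      "?h a - ?h 0 = (a - 0) * (L * log_gram_hess d n m (?c b) (?c' b) (?c' b))"
      using mean_value_within[OF second_derivative_along_geodesic[OF x v], of 0 a] a01
      by (metis order_refl less_imp_le)
    have b01: "b \<in> {0..1}" using a b by auto
    note cb = hexp_in_hyp[OF x v, of b] hexp'_tangent[OF x v, of b]
    have 1: "log_gram L d n m (c 1) - log_gram L d n m x - mink d (log_gram_grad L d n m x) v =
        ?h a - ?h 0"
      using a(2) mink_log_gram_grad[OF tangentD(1)[OF v], of L n m]
      by (simp add: c1 hexp_geodesic(2,3)[OF x v])
    have "\<bar>?h a - ?h 0\<bar> = a * L * log_gram_hess d n m (?c b) (?c' b) (?c' b)"
      unfolding b(2) using a01 L log_gram_hess_bounds(1)[OF cb] by (simp add: abs_mult)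
    also have "\<dots> \<le> 1 * L * mink d (?c' b) (?c' b)"
      by (intro mult_mono log_gram_hess_bounds[OF cb]) (use a01 L in simp_all)
    also have "\<dots> = L * tnorm d v * tnorm d v"
      using hexp'_norm[OF x v b01] tnorm_sq[OF x v] by (simp add: power2_eq_square)
    also have "\<dots> \<le> e * tnorm d v"
      using small L tnorm_nonneg[OF x v]
      by (intro mult_right_mono) (auto simp: v_def field_simps)
    finally show "\<bar>log_gram L d n m (c 1) - log_gram L d n m x -
        mink d (log_gram_grad L d n m x) (c' 0)\<bar> \<le> e * tnorm d (c' 0)"
      unfolding 1[unfolded v_def] by (simp only: v_def)
  qed
qed

lemma grad_log_gram:
  "x \<in> hyp d \<Longrightarrow> L > 0 \<Longrightarrow> grad d (log_gram L d n m) x = log_gram_grad L d n m x"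
  by (intro grad_eq has_gradient_log_gram)

text \<open>Pairing the gradient with the parallel extension \<open>U\<close> of \<open>u\<close>
  gives a function on the geodesic whose derivative is \<open>L\<close> times the Hessian at the
  velocity and \<open>U\<close>. Both fields have constant length, so the Hessian bound and one mean
  value suffice.\<close>

lemma log_gram_grad_difference_along_transport:
  assumes x: "x \<in> hyp d" and y: "y \<in> hyp d" and u: "u \<in> tangent d x" and L: "L > 0"
  shows "\<bar>mink d (log_gram_grad L d n m y) (transport d x y u) - mink d (log_gram_grad L d n m x) u\<bar>
           \<le> L * hdist d x y * tnorm d u"
proof -
  obtain v where v: "v \<in> tangent d x" and yv: "hexp d x v 1 = y"
    using geodesic_exists[OF x y] .
  let ?c = "hexp d x v" and ?c' = "hexp' d x v" and ?a = "mink d u v / mink d v v"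
  define U where "U = (\<lambda>t i. u i + ?a * (?c' t i - v i))"
  have U01: "U 0 = u" "U 1 = transport d x y u"
    using transport_hexp[OF x v u] by (simp_all add: U_def yv hexp_geodesic(3)[OF x v])
  have tan: "U t \<in> tangent d (?c t)" if "t \<in> {0..1}" for t
    using hexp_parallel[OF x v u] that by (auto simp: parallel_along_def U_def)
  \<comment> \<open>For a constant geodesic the quotient \<open>?a\<close> is \<open>0\<close> by
    convention, and both sides vanish.\<close>
  have am: "?a * mink d v v = mink d v u"
  proof (cases "mink d v v = 0")
    case True
    from mink_tangent_eq_0[OF x v this] show ?thesis by (simp add: mink_def)
  qed (simp add: mink_commute)
  have vel: "has_velocity U (\<lambda>i. mink d v u * ?c t i) t" for t
    unfolding has_velocity_def
  proof
    fix i
    have "((\<lambda>s. U s i) has_real_derivative ?a * (mink d v v * ?c t i)) (at t within {0..1})"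
      unfolding U_def
      using has_velocityD[OF hexp_has_velocity(2)[OF x v, of t], of i]
      by (auto intro!: derivative_eq_intros)
    thus "((\<lambda>s. U s i) has_real_derivative mink d v u * ?c t i) (at t within {0..1})"
      unfolding mult.assoc[symmetric] am .
  qed
  have cU: "mink d (?c' t) (U t) = mink d v u" if t: "t \<in> {0..1}" for t
    using mink_normal_velocities_constant[OF hexp'_tangent[OF x v] tan
        hexp_has_velocity(2)[OF x v] vel t]
    by (simp add: U01 hexp_geodesic(3)[OF x v])
  have UU: "tnorm d (U t) = tnorm d u" if t: "t \<in> {0..1}" for t
    using mink_normal_velocities_constant[OF tan tan vel vel t] by (simp add: tnorm_def U01)
  let ?h = "\<lambda>s. L * gram d n m (?c s) (U s) / (1 + gram d n m (?c s) (?c s))"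
  have "(?h has_real_derivative L * log_gram_hess d n m (?c t) (?c' t) (U t)) (at t within {0..1})"
    if t: "t \<in> {0..1}" for t
    by (rule log_gram_second_derivative[OF hexp_has_velocity(1)[OF x v]]) (simp add: cU[OF t] vel)
  from mean_value_within[OF this, of 0 1]
  obtain b where b: "b \<in> {0<..<1}" "?h 1 - ?h 0 = L * log_gram_hess d n m (?c b) (?c' b) (U b)"
    by auto
  have b01: "b \<in> {0..1}" using b by auto
  have "?h 1 = mink d (log_gram_grad L d n m y) (transport d x y u)"
    using mink_log_gram_grad[of d y "transport d x y u" L n m] tangentD(1)[OF tan[of 1]]
    by (simp add: yv U01)
  moreover have "?h 0 = mink d (log_gram_grad L d n m x) u"
    using mink_log_gram_grad[OF tangentD(1)[OF u], of L n m]
    by (simp add: U01 hexp_geodesic(2)[OF x v])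
  moreover have "\<bar>?h 1 - ?h 0\<bar> \<le> L * (tnorm d (?c' b) * tnorm d (U b))"
    unfolding b(2) abs_mult using L
    by (simp add: log_gram_hess_abs_le[OF hexp_in_hyp[OF x v] hexp'_tangent[OF x v] tan[OF b01]])
  moreover have "tnorm d (?c' b) = hdist d x y"
    using hdist_hexp[OF x v, of 0 1] hexp'_norm[OF x v b01]
    by (simp add: yv hexp_geodesic(2)[OF x v] tnorm_def)
  ultimately show ?thesis by (simp add: UU[OF b01] mult.assoc)
qed

text \<open>Duality: the preceding estimate is tested with \<open>w\<close>, the gradient difference
  itself. It bounds the squared norm of \<open>w\<close> by \<open>L * hdist d x y\<close> times the
  norm, which is then cancelled.\<close>

lemma L_smooth_log_gram:
  assumes L: "L > 0"
  shows "L_smooth d L (log_gram L d n m)"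
  unfolding L_smooth_def
proof (intro conjI ballI)
  show "differentiable_hyp d (log_gram L d n m)"
    unfolding differentiable_hyp_def using has_gradient_log_gram[OF _ L] by blast
  fix x y assume x: "x \<in> hyp d" and y: "y \<in> hyp d"
  define Gx Gy where "Gx = log_gram_grad L d n m x" and "Gy = log_gram_grad L d n m y"
  have Gx: "Gx \<in> tangent d x" and Gy: "Gy \<in> tangent d y"
    by (simp_all add: Gx_def Gy_def log_gram_grad_tangent x y)
  let ?k = "1 - mink d x y"
  have k: "?k \<noteq> 0" using mink_hyp_le[OF x y] by simp
  define P where "P = transport d y x Gy"
  have P: "P = (\<lambda>i. Gy i + mink d x Gy / ?k * (y i + x i))"
    unfolding P_def using transport_eq[OF y x Gy] by (simp add: mink_commute)
  have "mink d x P = mink d x Gy + mink d x Gy / ?k * (mink d x y + mink d x x)"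
    unfolding P mink_add_right mink_scale_right ..
  also have "\<dots> = mink d x Gy - mink d x Gy / ?k * ?k"
    unfolding hypD(1)[OF x] by (simp only: algebra_simps)
  also have "\<dots> = 0" using k by simp
  finally have Pt: "P \<in> tangent d x"
    using hypD(3)[OF x] hypD(3)[OF y] tangentD(3)[OF Gy]
    by (auto simp: tangent_def minkowski_space_def P)
  define w where "w = (\<lambda>i. Gx i - P i)"
  have w: "w \<in> tangent d x"
    using Gx Pt by (simp add: w_def tangent_def minkowski_space_def mink_diff_right)
  \<comment> \<open>Transport from \<open>x\<close> to \<open>y\<close> is adjoint to transport from
    \<open>y\<close> to \<open>x\<close>: in the closed formula the pairings of \<open>Gy\<close>
    with \<open>y\<close> and of \<open>w\<close> with \<open>x\<close> vanish, and the remaining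
    terms are symmetric.\<close>
  have "mink d Gy (transport d x y w) = mink d Gy w + mink d y w / ?k * mink d Gy x"
    unfolding transport_eq[OF x y w] mink_add_right mink_scale_right
    using tangentD(2)[OF Gy] by simp
  also have "\<dots> = mink d P w"
    unfolding P mink_add_left mink_scale_left
    using tangentD(1)[OF w] by (simp add: mink_commute[of d Gy])
  finally have "(tnorm d w)\<^sup>2 = - (mink d Gy (transport d x y w) - mink d Gx w)"
    unfolding tnorm_sq[OF x w] by (simp add: mink_diff_left w_def)
  hence "tnorm d w * tnorm d w \<le> L * hdist d x y * tnorm d w"
    using log_gram_grad_difference_along_transport[OF x y w L]
    by (simp add: Gx_def Gy_def power2_eq_square)
  moreover have "hdist d x y \<ge> 0"
    using mink_hyp_le[OF x y] by (simp add: hdist_def arcosh_nonneg_real)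
  ultimately have "tnorm d w \<le> L * hdist d x y"
    using tnorm_nonneg[OF x w] L by (cases "tnorm d w = 0") auto
  thus "tnorm d (\<lambda>i. grad d (log_gram L d n m) x i -
      transport d y x (grad d (log_gram L d n m) y) i) \<le> L * hdist d x y"
    by (simp add: grad_log_gram x y L w_def P_def Gx_def Gy_def)
qed

end

section \<open>Orthonormal frames and the chain of hyperplanes\<close>

text \<open>Gaussian elimination by induction on the equations: the new equation is solved for an
  unknown \<open>q\<close> with nonzero coefficient, which is then eliminated from the
  others.\<close>

lemma homogeneous_system_nontrivial_solution:
  fixes Y :: "'j \<Rightarrow> 'i \<Rightarrow> real"
  assumes "finite J" "finite I" "card J < card I"
  shows "\<exists>w. (\<forall>i. i \<notin> I \<longrightarrow> w i = 0) \<and> (\<exists>i. w i \<noteq> 0) \<and> (\<forall>j\<in>J. (\<Sum>i\<in>I. Y j i * w i) = 0)"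
  using assms
proof (induction J arbitrary: I Y rule: finite_induct)
  case empty
  then obtain i0 where "i0 \<in> I" by fastforce
  then show ?case by (intro exI[of _ "\<lambda>i. if i = i0 then 1 else 0"]) auto
next
  case (insert j0 J)
  show ?case
  proof (cases "\<forall>i\<in>I. Y j0 i = 0")
    case True
    have "card J < card I" using insert by simp
    from insert.IH[OF insert.prems(1) this, of Y] obtain w
      where "\<forall>i. i \<notin> I \<longrightarrow> w i = 0" "\<exists>i. w i \<noteq> 0" "\<forall>j\<in>J. (\<Sum>i\<in>I. Y j i * w i) = 0"
      by blast
    with True show ?thesis by (intro exI[of _ w]) auto
  next
    case False
    then obtain q where q: "q \<in> I" "Y j0 q \<noteq> 0" by blast
    let ?I = "I - {q}"
    define Y' where "Y' = (\<lambda>j i. Y j i - Y j q * Y j0 i / Y j0 q)"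
    have "card J < card ?I" using insert q by simp
    from insert.IH[OF _ this, of Y'] insert.prems obtain w where
      w: "\<forall>i. i \<notin> ?I \<longrightarrow> w i = 0" "\<exists>i. w i \<noteq> 0" "\<forall>j\<in>J. (\<Sum>i\<in>?I. Y' j i * w i) = 0"
      by auto
    define s where "s = (\<Sum>i\<in>?I. Y j0 i * w i)"
    define w' where "w' = w(q := - s / Y j0 q)"
    have split: "(\<Sum>i\<in>I. Y j i * w' i) = Y j q * (- s / Y j0 q) + (\<Sum>i\<in>?I. Y j i * w i)" for j
    proof -
      have "(\<Sum>i\<in>I. Y j i * w' i) = Y j q * w' q + (\<Sum>i\<in>?I. Y j i * w' i)"
        by (rule sum.remove) (use insert.prems q in auto)
      also have "(\<Sum>i\<in>?I. Y j i * w' i) = (\<Sum>i\<in>?I. Y j i * w i)"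
        by (rule sum.cong) (auto simp: w'_def)
      finally show ?thesis by (simp add: w'_def)
    qed
    have "(\<Sum>i\<in>?I. Y' j i * w i) = (\<Sum>i\<in>?I. Y j i * w i) - Y j q / Y j0 q * s" for j
      unfolding s_def sum_distrib_left sum_subtractf[symmetric]
      by (rule sum.cong) (simp_all add: Y'_def algebra_simps)
    with w(3) have "\<forall>j\<in>J. (\<Sum>i\<in>I. Y j i * w' i) = 0" by (simp add: split)
    moreover have "(\<Sum>i\<in>I. Y j0 i * w' i) = 0" using q by (simp add: split s_def)
    moreover have "\<forall>i. i \<notin> I \<longrightarrow> w' i = 0" using w(1) q by (auto simp: w'_def)
    moreover have "\<exists>i. w' i \<noteq> 0"
    proof -
      from w(2) obtain i where "w i \<noteq> 0" by blast
      moreover from this w(1) have "i \<noteq> q" by auto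
      ultimately show ?thesis by (auto simp: w'_def)
    qed
    ultimately show ?thesis by blast
  qed
qed

text \<open>The sign of the time coordinate is moved into the coefficients, so that orthogonality
  becomes an equation of a linear system.\<close>

lemma mink_eq_sum: "mink d y w = (\<Sum>i\<le>d. (if i = 0 then - y 0 else y i) * w i)"
proof -
  have "(\<Sum>i\<le>d. (if i = 0 then - y 0 else y i) * w i) =
      - y 0 * w 0 + (\<Sum>i=1..d. (if i = 0 then - y 0 else y i) * w i)"
    unfolding atMost_atLeast0 by (subst sum.atLeast_Suc_atMost) simp_all
  also have "(\<Sum>i=1..d. (if i = 0 then - y 0 else y i) * w i) = (\<Sum>i=1..d. y i * w i)"
    by (rule sum.cong) auto
  finally show ?thesis by (simp add: mink_def)
qed

text \<open>Orthogonality to \<open>p\<close> and \<open>S\<close> is at most \<open>d\<close>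
  equations in \<open>d + 1\<close> unknowns. A nonzero solution is tangent at \<open>p\<close>,
  where the metric is positive definite, and can be normalised.\<close>

lemma orthogonal_unit_tangent_vector:
  assumes p: "p \<in> hyp d" and S: "finite S" "card S < d"
  obtains u where "u \<in> tangent d p" "mink d u u = 1" "\<And>y. y \<in> S \<Longrightarrow> mink d y u = 0"
proof -
  have "card (insert p S) < card {..d}"
    using S by (simp add: card_insert_if)
  moreover have "finite (insert p S)" using S by simp
  ultimately obtain w where w: "\<forall>i. i \<notin> {..d} \<longrightarrow> w i = 0" "\<exists>i. w i \<noteq> 0"
    and "\<forall>y\<in>insert p S. (\<Sum>i\<le>d. (if i = 0 then - y 0 else y i) * w i) = 0"
    using homogeneous_system_nontrivial_solution[of "insert p S" "{..d}"
        "\<lambda>y i. if i = 0 then - y 0 else y i"] finite_atMost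
    by blast
  hence ortho: "\<forall>y\<in>insert p S. mink d y w = 0" by (simp only: mink_eq_sum)
  have t: "w \<in> tangent d p" using w ortho by (auto simp: tangent_def minkowski_space_def)
  define N where "N = tnorm d w"
  have N: "N \<noteq> 0" using tnorm_eq_0[OF p t] w(2) by (auto simp: N_def)
  have N2: "mink d w w = N\<^sup>2" using tnorm_sq[OF p t] by (simp add: N_def)
  define u where "u = (\<lambda>i. 1 / N * w i)"
  show thesis
  proof (rule that)
    have "mink d p u = 0" unfolding u_def mink_scale_right using tangentD(1)[OF t] by simp
    moreover have "u \<in> minkowski_space d"
      using tangentD(3)[OF t] by (simp add: minkowski_space_def u_def)
    ultimately show "u \<in> tangent d p" by (simp add: tangent_def)
    show "mink d u u = 1"
      unfolding u_def mink_scale_left mink_scale_right N2 using N by (simp add: power2_eq_square)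
    show "mink d y u = 0" if "y \<in> S" for y
      unfolding u_def mink_scale_right using ortho that by simp
  qed
qed

definition orthonormal_frame :: "nat \<Rightarrow> vec \<Rightarrow> (nat \<Rightarrow> vec) \<Rightarrow> nat \<Rightarrow> bool" where
  "orthonormal_frame d p e m \<longleftrightarrow>
     (\<forall>i<m. e i \<in> tangent d p) \<and> (\<forall>i<m. \<forall>j<m. mink d (e i) (e j) = (if i = j then 1 else 0))"

lemma mink_frame_sum:
  assumes "orthonormal_frame d p e m" "j < m"
  shows "mink d (e j) (\<lambda>k. \<Sum>i<m. g i * e i k) = g j"
proof -
  have "(\<Sum>i<m. g i * mink d (e j) (e i)) = (\<Sum>i<m. if i = j then g j else 0)"
    using assms by (intro sum.cong) (auto simp: orthonormal_frame_def)
  with assms(2) show ?thesis by (simp add: mink_sum_right)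
qed

lemma frame_sum_tangent:
  assumes "orthonormal_frame d p e m"
  shows "(\<lambda>k. \<Sum>i<m. g i * e i k) \<in> tangent d p"
proof -
  have e: "e i \<in> tangent d p" if "i < m" for i using assms that by (simp add: orthonormal_frame_def)
  have "mink d p (\<lambda>k. \<Sum>i<m. g i * e i k) = 0" by (simp add: mink_sum_right tangentD(1)[OF e])
  thus ?thesis using tangentD(3)[OF e] by (simp add: tangent_def minkowski_space_def)
qed

lemma mink_frame_sum_self:
  assumes "orthonormal_frame d p e m"
  shows "mink d (\<lambda>k. \<Sum>i<m. g i * e i k) (\<lambda>k. \<Sum>i<m. g i * e i k) = (\<Sum>i<m. (g i)\<^sup>2)"
proof -
  let ?s = "\<lambda>k. \<Sum>i<m. g i * e i k"
  have "mink d ?s (e i) = g i" if "i < m" for i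
    using mink_frame_sum[OF assms that, of g] by (subst mink_commute)
  thus ?thesis by (subst mink_sum_right) (simp add: power2_eq_square)
qed

text \<open>The projection \<open>s\<close> of \<open>w\<close> to the span of the frame is
  subtracted; the remainder is still tangent at \<open>p\<close>, so its square is
  nonnegative.\<close>

lemma bessel_inequality:
  assumes p: "p \<in> hyp d" and e: "orthonormal_frame d p e m" and w: "w \<in> tangent d p"
  shows "(\<Sum>i<m. (mink d (e i) w)\<^sup>2) \<le> mink d w w"
proof -
  define g where "g = (\<lambda>i. mink d (e i) w)"
  define s where "s = (\<lambda>k. \<Sum>i<m. g i * e i k)"
  have s: "s \<in> tangent d p" unfolding s_def by (rule frame_sum_tangent[OF e])
  have z: "(\<lambda>k. w k - s k) \<in> tangent d p"
    using w s by (simp add: tangent_def minkowski_space_def mink_diff_right)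
  have ss: "mink d s s = (\<Sum>i<m. (g i)\<^sup>2)" unfolding s_def by (rule mink_frame_sum_self[OF e])
  have ws: "mink d w s = (\<Sum>i<m. (g i)\<^sup>2)"
    unfolding s_def mink_sum_right by (simp add: g_def mink_commute[of d w] power2_eq_square)
  have "mink d (\<lambda>k. w k - s k) (\<lambda>k. w k - s k) = mink d w w - mink d s s"
    unfolding mink_diff_left mink_diff_right using ss ws mink_commute[of d s w] by simp
  with mink_tangent_nonneg[OF p z] show ?thesis by (simp add: ss g_def)
qed

text \<open>The frame is shifted by one to make room for the head \<open>- c * p\<close>, whose
  product with a point of the hyperboloid is \<open>c\<close> times the hyperbolic cosine of its
  distance from \<open>p\<close>.\<close>

definition chain_vector :: "real \<Rightarrow> vec \<Rightarrow> (nat \<Rightarrow> vec) \<Rightarrow> nat \<Rightarrow> vec" where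
  "chain_vector c p e i = (case i of 0 \<Rightarrow> (\<lambda>k. - c * p k) | Suc j \<Rightarrow> e j)"

text \<open>The factor \<open>1 / 2\<close> makes the form contractive: squaring a difference costs
  a factor 2, and each frame vector occurs in at most two differences.\<close>

definition chain_normal :: "real \<Rightarrow> vec \<Rightarrow> (nat \<Rightarrow> vec) \<Rightarrow> nat \<Rightarrow> vec" where
  "chain_normal c p e i = (\<lambda>k. 1 / 2 * (chain_vector c p e i k - chain_vector c p e (Suc i) k))"

lemma mink_chain_normal:
  "mink d (chain_normal c p e i) x =
     1 / 2 * (mink d (chain_vector c p e i) x - mink d (chain_vector c p e (Suc i)) x)"
  unfolding chain_normal_def mink_scale_left mink_diff_left ..

lemma mink_chain_vector:
  "mink d (chain_vector c p e 0) x = - c * mink d p x"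
  "mink d (chain_vector c p e (Suc i)) x = mink d (e i) x"
  by (simp_all only: chain_vector_def mink_scale_left nat.case)

text \<open>The head of the chain is orthogonal to the tangent space at \<open>p\<close>, so only
  frame coordinates contribute, each at most twice; Bessel's inequality bounds their
  squares.\<close>

lemma contractive_gram_chain_normal:
  assumes p: "p \<in> hyp d" and e: "orthonormal_frame d p e m"
  shows "contractive_gram d (chain_normal c p e) m p"
proof
  show "chain_normal c p e i \<in> minkowski_space d" if "i < m" for i
    using that e hypD(3)[OF p]
    by (auto simp: chain_normal_def chain_vector_def minkowski_space_def orthonormal_frame_def
        tangent_def split: nat.splits)
next
  fix w assume w: "w \<in> tangent d p"
  define \<sigma> where "\<sigma> = (\<lambda>i. mink d (chain_vector c p e i) w)"
  have \<sigma>0: "\<sigma> 0 = 0" using tangentD(1)[OF w] by (simp add: \<sigma>_def mink_chain_vector)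
  have "(\<Sum>i<m. (\<sigma> i)\<^sup>2) \<le> (\<Sum>i<Suc m. (\<sigma> i)\<^sup>2)" by simp
  also have "\<dots> = (\<Sum>i<m. (\<sigma> (Suc i))\<^sup>2)" unfolding sum.lessThan_Suc_shift by (simp add: \<sigma>0)
  finally have shift: "(\<Sum>i<m. (\<sigma> i)\<^sup>2) \<le> (\<Sum>i<m. (\<sigma> (Suc i))\<^sup>2)" .
  have "gram d (chain_normal c p e) m w w = (\<Sum>i<m. (1 / 2 * (\<sigma> i - \<sigma> (Suc i)))\<^sup>2)"
    unfolding gram_def mink_chain_normal \<sigma>_def by (simp add: power2_eq_square)
  also have "\<dots> \<le> (\<Sum>i<m. 1 / 2 * ((\<sigma> i)\<^sup>2 + (\<sigma> (Suc i))\<^sup>2))"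
  proof (rule sum_mono)
    fix i
    have "0 \<le> (\<sigma> i + \<sigma> (Suc i))\<^sup>2" by simp
    thus "(1 / 2 * (\<sigma> i - \<sigma> (Suc i)))\<^sup>2 \<le> 1 / 2 * ((\<sigma> i)\<^sup>2 + (\<sigma> (Suc i))\<^sup>2)"
      by (simp add: power2_eq_square algebra_simps)
  qed
  also have "\<dots> \<le> (\<Sum>i<m. (\<sigma> (Suc i))\<^sup>2)"
    unfolding sum_distrib_left[symmetric] sum.distrib using shift by simp
  also have "\<dots> \<le> mink d w w"
    using bessel_inequality[OF p e w] by (simp add: \<sigma>_def mink_chain_vector)
  finally show "gram d (chain_normal c p e) m w w \<le> mink d w w" .
qed (rule p)

text \<open>The products with the chain vectors start at a value of at least \<open>c\<close> and
  reach \<open>0\<close> at index \<open>Suc j\<close>. The drop telescopes into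
  \<open>Suc j \<le> m\<close> differences, and Cauchy-Schwarz bounds their squares from below; the
  4 comes from the halved normals.\<close>

lemma gram_chain_normal_ge:
  assumes p: "p \<in> hyp d" and x: "x \<in> hyp d" and c: "c \<ge> 0"
    and j: "j < m" "mink d (e j) x = 0"
  shows "c\<^sup>2 / (4 * m) \<le> gram d (chain_normal c p e) m x x"
proof -
  define \<sigma> where "\<sigma> = (\<lambda>i. mink d (chain_vector c p e i) x)"
  let ?b = "\<lambda>i. mink d (chain_normal c p e i) x"
  have b: "\<sigma> i - \<sigma> (Suc i) = 2 * ?b i" for i by (simp add: mink_chain_normal \<sigma>_def)
  have "c * 1 \<le> c * (- mink d p x)" using mink_hyp_le[OF p x] c by (intro mult_left_mono) auto
  hence "c \<le> \<sigma> 0" by (simp add: \<sigma>_def mink_chain_vector)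
  also have "\<sigma> 0 = \<sigma> 0 - \<sigma> (Suc j)" using j by (simp add: \<sigma>_def mink_chain_vector)
  also have "\<dots> = (\<Sum>i<Suc j. \<sigma> i - \<sigma> (Suc i))" by (rule sum_lessThan_telescope'[symmetric])
  also have "\<dots> = 2 * (\<Sum>i<Suc j. 1 * ?b i)" unfolding b sum_distrib_left[symmetric] by simp
  finally have "c\<^sup>2 \<le> (2 * (\<Sum>i<Suc j. 1 * ?b i))\<^sup>2" using c by (rule power_mono)
  also have "\<dots> = 4 * (\<Sum>i<Suc j. 1 * ?b i)\<^sup>2" by (subst power_mult_distrib) simp
  also have "(\<Sum>i<Suc j. 1 * ?b i)\<^sup>2 \<le> (\<Sum>i<Suc j. 1\<^sup>2) * (\<Sum>i<Suc j. (?b i)\<^sup>2)"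
    by (rule Cauchy_Schwarz_ineq_sum)
  also have "\<dots> \<le> real m * (\<Sum>i<m. (?b i)\<^sup>2)"
    using j by (intro mult_mono sum_mono2 sum_nonneg) auto
  also have "(\<Sum>i<m. (?b i)\<^sup>2) = gram d (chain_normal c p e) m x x"
    by (simp add: gram_def power2_eq_square)
  finally show ?thesis using j by (simp add: divide_le_eq mult_ac)
qed

text \<open>From \<open>p\<close> one moves by \<open>r\<close> along the diagonal of the frame. All
  frame products become \<open>sinh r / sqrt m\<close>, and the head gives
  \<open>c * cosh r\<close>; this \<open>c\<close> makes them equal, so all differences
  vanish.\<close>

lemma chain_normal_common_zero:
  assumes p: "p \<in> hyp d" and e: "orthonormal_frame d p e m" and r: "r > 0" and m: "m > 0"
  obtains z where "z \<in> hyp d" "hdist d p z = r"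
    "gram d (chain_normal (tanh r / sqrt m) p e) m z z = 0"
proof
  define v where "v = (\<lambda>k. \<Sum>i<m. r / sqrt m * e i k)"
  let ?z = "hexp d p v 1" and ?c = "tanh r / sqrt m"
  have v: "v \<in> tangent d p" unfolding v_def by (rule frame_sum_tangent[OF e])
  have "mink d v v = r\<^sup>2"
    unfolding v_def mink_frame_sum_self[OF e] using m by (simp add: power_divide)
  hence n: "tnorm d v = r" using r by (simp add: tnorm_def)
  show "?z \<in> hyp d" by (rule hexp_in_hyp[OF p v])
  show "hdist d p ?z = r" using hdist_hexp[OF p v, of 0 1] by (simp add: hexp_geodesic(2)[OF p v] n)
  have z: "mink d y ?z = cosh r * mink d y p + sinh r / r * mink d y v" for y
    unfolding hexp_def mink_combination n by simp
  have pz: "mink d p ?z = - cosh r" unfolding z using hypD(1)[OF p] tangentD(1)[OF v] by simp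
  have ez: "mink d (e i) ?z = sinh r / sqrt m" if "i < m" for i
  proof -
    have "mink d (e i) p = 0"
      using e that by (auto simp: orthonormal_frame_def tangent_def mink_commute[of d "e i"])
    moreover have "mink d (e i) v = r / sqrt m" unfolding v_def by (rule mink_frame_sum[OF e that])
    ultimately show ?thesis unfolding z using r by simp
  qed
  have \<sigma>: "mink d (chain_vector ?c p e i) ?z = sinh r / sqrt m" if "i \<le> m" for i
    using that by (cases i) (simp_all add: mink_chain_vector pz ez tanh_def)
  show "gram d (chain_normal ?c p e) m ?z ?z = 0"
    by (simp add: gram_def mink_chain_normal \<sigma>)
qed

section \<open>The resisting oracle\<close>

text \<open>The last vector enters value and gradient only through its product with
  \<open>x\<close>. A new link orthogonal to a query is therefore invisible there.\<close>

lemma log_gram_Suc: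
  assumes "mink d (n m) x = 0" and "\<And>i. i < m \<Longrightarrow> n i = n' i"
  shows "log_gram L d n (Suc m) x = log_gram L d n' m x"
    and "log_gram_grad L d n (Suc m) x = log_gram_grad L d n' m x"
  using assms by (simp_all add: log_gram_def log_gram_grad_def gram_def)

text \<open>Query \<open>j\<close> depends only on earlier answers. Agreement is demanded at the
  queries made for \<open>f\<close>; by induction those made for \<open>g\<close> are the
  same.\<close>

lemma history_eqI:
  assumes "\<And>j. j < k \<Longrightarrow> f (query A d f j) = g (query A d f j) \<and>
                        grad d f (query A d f j) = grad d g (query A d f j)"
  shows "history A d f k = history A d g k"
  using assms
proof (induction k)
  case (Suc k)
  have eq: "history A d f k = history A d g k" by (rule Suc.IH) (simp add: Suc.prems)
  from Suc.prems[of k] show ?case by (simp add: Let_def query_def eq)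
qed simp

lemma query_in_hyp:
  assumes A: "first_order_algorithm A" and d: "d \<ge> 2"
    and f: "\<And>x. x \<in> hyp d \<Longrightarrow> grad d f x \<in> tangent d x"
  shows "query A d f k \<in> hyp d"
proof -
  have *: "A d h \<in> hyp d" if "h \<in> lists (UNIV \<times> tangent_bundle d)" for h
    using A d that by (auto simp: first_order_algorithm_def)
  have "history A d f k \<in> lists (UNIV \<times> tangent_bundle d)"
  proof (induction k)
    case (Suc k)
    with *[OF Suc] f show ?case by (simp add: Let_def tangent_bundle_def)
  qed simp
  from *[OF this] show ?thesis by (simp add: query_def)
qed

text \<open>Each new frame vector is chosen orthogonal to all queries made so far, so that adding it to the
  chain changes neither values nor gradients at these queries.\<close>

lemma resisting_frame:
  assumes A: "first_order_algorithm A" and d: "d \<ge> 2" and p: "p \<in> hyp d" and L: "L > 0"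
    and m: "2 * m \<le> d"
  shows "\<exists>e. orthonormal_frame d p e m \<and> (\<forall>j<m. \<forall>i<m. j \<le> i \<longrightarrow>
           mink d (e i) (query A d (log_gram L d (chain_normal c p e) m) j) = 0)"
  using m
proof (induction m)
  case 0
  then show ?case by (simp add: orthonormal_frame_def)
next
  case (Suc m)
  from Suc.IH Suc.prems obtain e where e: "orthonormal_frame d p e m"
    and hidden: "\<And>i j. j < m \<Longrightarrow> i < m \<Longrightarrow> j \<le> i \<Longrightarrow>
      mink d (e i) (query A d (log_gram L d (chain_normal c p e) m) j) = 0" by auto
  define f where "f = log_gram L d (chain_normal c p e) m"
  interpret e: contractive_gram d "chain_normal c p e" m p
    by (rule contractive_gram_chain_normal[OF p e])
  have query: "query A d f j \<in> hyp d" for j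
    by (rule query_in_hyp[OF A d])
      (simp add: f_def e.grad_log_gram L e.log_gram_grad_tangent)
  \<comment> \<open>At most \<open>2 * m + 1\<close> vectors, fewer than \<open>d\<close> since
    \<open>2 * Suc m \<le> d\<close>. Query \<open>m\<close> is included because it is determined by
    the first \<open>m\<close> answers, which the extension preserves.\<close>
  let ?S = "e ` {..<m} \<union> query A d f ` {..m}"
  have "card ?S \<le> m + Suc m"
    using card_Un_le[of "e ` {..<m}" "query A d f ` {..m}"]
      card_image_le[of "{..<m}" e] card_image_le[of "{..m}" "query A d f"] by simp
  hence "card ?S < d" using Suc.prems by simp
  then obtain u where u: "u \<in> tangent d p" "mink d u u = 1" "\<And>y. y \<in> ?S \<Longrightarrow> mink d y u = 0"
    using orthogonal_unit_tangent_vector[OF p, of ?S] by blast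
  have eu: "mink d (e i) u = 0" "mink d u (e i) = 0" if "i < m" for i
    using u(3)[of "e i"] that by (auto simp: mink_commute[of d u])
  have uq: "mink d u (query A d f j) = 0" if "j \<le> m" for j
    using u(3)[of "query A d f j"] that by (auto simp: mink_commute[of d u])
  define e' where "e' = e(m := u)"
  define f' where "f' = log_gram L d (chain_normal c p e') (Suc m)"
  have e': "orthonormal_frame d p e' (Suc m)"
    using e u(1,2) eu by (auto simp: orthonormal_frame_def e'_def less_Suc_eq)
  interpret e': contractive_gram d "chain_normal c p e'" "Suc m" p
    by (rule contractive_gram_chain_normal[OF p e'])
  have normal: "chain_normal c p e' i = chain_normal c p e i" if "i < m" for i
    using that by (auto simp: chain_normal_def chain_vector_def e'_def split: nat.splits)
  have "f (query A d f j) = f' (query A d f j) \<and>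
      grad d f (query A d f j) = grad d f' (query A d f j)" if j: "j < m" for j
  proof -
    \<comment> \<open>The new link is half the difference of \<open>e m'\<close> and
      \<open>u\<close>. The induction hypothesis makes \<open>e m'\<close> orthogonal to query
      \<open>j\<close>, as \<open>j \<le> m'\<close>, and \<open>u\<close> is so by choice.\<close>
    obtain m' where m': "m = Suc m'" using j by (cases m) auto
    have "mink d (e m') (query A d f j) = 0" using hidden[of j m'] j by (simp add: m' f_def)
    hence "mink d (chain_normal c p e' m) (query A d f j) = 0"
      using uq[of j] j by (simp add: mink_chain_normal m' mink_chain_vector e'_def)
    from log_gram_Suc[where n = "chain_normal c p e'" and n' = "chain_normal c p e", OF this normal]
    show ?thesis
      by (simp add: f_def f'_def e.grad_log_gram e'.grad_log_gram L query[unfolded f_def])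
  qed
  \<comment> \<open>Equal histories of length \<open>m\<close> also fix query \<open>m\<close>,
    although \<open>f\<close> and \<open>f'\<close> may differ at that point.\<close>
  hence "history A d f j = history A d f' j" if "j \<le> m" for j
    using that by (intro history_eqI) auto
  hence same: "query A d f' j = query A d f j" if "j \<le> m" for j
    using that by (simp add: query_def)
  have "mink d (e' i) (query A d f' j) = 0" if "j < Suc m" "i < Suc m" "j \<le> i" for i j
    using that hidden[of j i] uq[of j] by (cases "i = m") (auto simp: same e'_def f_def)
  with e' show ?case unfolding f'_def by blast
qed

section \<open>The lower bound on the number of queries\<close>

theorem theorem11:
  fixes r L :: real and T :: nat and xref :: "nat \<Rightarrow> vec" and A :: algorithm
  assumes "r > 0" and "L > 0" and "T > 0"
    and "\<And>d. d \<ge> 2 \<Longrightarrow> xref d \<in> hyp d"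
    and "first_order_algorithm A"
  shows "\<exists>(d, f) \<in> smooth_class xref r L.
           query_complexity A d f (1/2 * L * r\<^sup>2 * (1 / (8 * (zeta r)\<^sup>2 * (real T)\<^sup>2))) \<ge> enat T"
proof -
  note r = \<open>r > 0\<close> and L = \<open>L > 0\<close> and T = \<open>T > 0\<close> and A = \<open>first_order_algorithm A\<close>
  define d where "d = 2 * T + 2"
  define p where "p = xref d"
  define c where "c = tanh r / sqrt T"
  define \<delta> where "\<delta> = 1/2 * L * r\<^sup>2 * (1 / (8 * (zeta r)\<^sup>2 * (real T)\<^sup>2))"
  have d: "d \<ge> 2" and p: "p \<in> hyp d" using assms(4) by (simp_all add: d_def p_def)
  have "2 * T \<le> d" by (simp add: d_def)
  from resisting_frame[OF A d p L this, of c] obtain e where e: "orthonormal_frame d p e T"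
    and hidden: "\<And>j. j < T \<Longrightarrow> mink d (e j) (query A d (log_gram L d (chain_normal c p e) T) j) = 0"
    by blast
  define f where "f = log_gram L d (chain_normal c p e) T"
  interpret contractive_gram d "chain_normal c p e" T p
    by (rule contractive_gram_chain_normal[OF p e])
  obtain z where z: "z \<in> hyp d" "hdist d p z = r" "gram d (chain_normal c p e) T z z = 0"
    using chain_normal_common_zero[OF p e r T] unfolding c_def .
  have fz: "f z = 0" by (simp add: f_def log_gram_def z(3))
  have f_nonneg: "f x \<ge> 0" for x
    using L gram_nonneg[of d "chain_normal c p e" T x] by (simp add: f_def log_gram_def)
  have fmin: "fmin d f = 0"
    unfolding fmin_def
  proof (rule cInf_eq_minimum)
    show "0 \<in> f ` hyp d" using fz z(1) by force
  qed (use f_nonneg in auto)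
  have "global_minimizer d f z" using z(1) fz f_nonneg by (simp add: global_minimizer_def)
  hence "(d, f) \<in> smooth_class xref r L"
    using d z gconvex_log_gram[of L] L_smooth_log_gram[OF L] L
    by (auto simp: smooth_class_def smooth_class_dim_def hball_def f_def simp flip: p_def)
  moreover have "enat T \<le> query_complexity A d f \<delta>"
    unfolding query_complexity_def
  proof (rule INF_greatest)
    fix k assume "k \<in> {k. f (query A d f k) - fmin d f \<le> \<delta>}"
    hence small: "f (query A d f k) \<le> \<delta>" by (simp add: fmin)
    have "\<not> k < T"
    proof
      assume k: "k < T"
      \<comment> \<open>The lower bound for the form at a query that is orthogonal to some vector of
        the frame.\<close>
      define y where "y = c\<^sup>2 / (4 * real T)"
      have th: "0 < tanh r" "tanh r < 1" using r tanh_real_lt_1[of r] by simp_all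
      have y_eq: "y = (tanh r)\<^sup>2 / (4 * (real T)\<^sup>2)"
        using T by (simp add: y_def c_def power_divide power2_eq_square)
      have y0: "y > 0" using th T by (simp add: y_eq)
      have "(tanh r)\<^sup>2 \<le> 1" using th by (simp add: power_le_one)
      moreover have "1 \<le> (real T)\<^sup>2" using T by (intro one_le_power) simp
      ultimately have "(tanh r)\<^sup>2 \<le> (real T)\<^sup>2" by linarith
      hence y1: "y \<le> 1 / 4" using T by (simp add: y_eq divide_le_eq)
      have query: "query A d f k \<in> hyp d"
        by (rule query_in_hyp[OF A d]) (simp add: f_def grad_log_gram L log_gram_grad_tangent)
      have "c \<ge> 0" using th by (simp add: c_def)
      from gram_chain_normal_ge[OF p query this k] hidden[OF k]
      have "y \<le> gram d (chain_normal c p e) T (query A d f k) (query A d f k)"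
        by (simp add: y_def f_def)
      hence "L / 2 * ln (1 + y) \<le> f (query A d f k)"
        unfolding f_def log_gram_def using L y0 by (intro mult_left_mono) auto
      \<comment> \<open>The logarithm loses less than a factor 2 because
        \<open>y \<le> 1 / 4\<close>; strictness is what contradicts accuracy
        \<open>\<delta>\<close>.\<close>
      moreover have "y / 2 < ln (1 + y)"
      proof -
        have "y * y < y * (1 / 2)" using y0 y1 by (intro mult_strict_left_mono) auto
        moreover have "y - y\<^sup>2 \<le> ln (1 + y)" using y0 y1 by (intro ln_one_plus_pos_lower_bound) auto
        ultimately show ?thesis by (simp add: power2_eq_square)
      qed
      hence "L / 2 * (y / 2) < L / 2 * ln (1 + y)" using L by (intro mult_strict_left_mono) auto
      \<comment> \<open>Since \<open>r / zeta r = tanh r\<close>, the accuracy equals this bound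
        exactly.\<close>
      moreover have "\<delta> = L / 2 * (y / 2)"
        using r th T by (simp add: \<delta>_def y_eq zeta_def power_divide)
      ultimately show False using small by simp
    qed
    thus "enat T \<le> enat k" by simp
  qed
  ultimately show ?thesis unfolding \<delta>_def by blast
qed

end
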